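(* Let $G$ be an undirected graph on $n$ vertices and let $F_1,F_2,\dots,F_n$ be nonempty sets of edges of $G$, each of size at most $2$. Then $G$ has a rainbow cycle (with respect to $F_1,\dots,F_n$) of length at most $\left\lceil \sum_{i=1}^n \frac{1}{|F_i|}\right\rceil$.
   Context: A set $R$ of edges is rainbow if $R=\{e_{i_1},\dots,e_{i_k}\}$ for distinct indices $i_1<\dots<i_k$ with $e_{i_j}\in F_{i_j}$, i.e. it is the image of a partial choice function picking at most one edge from each $F_i$. A rainbow cycle is a cycle whose edges are chosen in this way from distinct sets $F_i$; in particular, an edge belonging to two different sets $F_i,F_j$ yields (two copies of the edge, one from each set) a rainbow cycle of length $2$. *)

theory Defs
  imports Complex_Main
begin

definition simple_graph :: "'a set \<Rightarrow> 'a set set \<Rightarrow> bool" where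
  "simple_graph V E \<longleftrightarrow> finite V \<and> (\<forall>e\<in>E. e \<subseteq> V \<and> card e = 2)"

text \<open>
  The consecutive edges of the closed walk through a list of vertices, returning from the
  last vertex to the first. The result is a list, not a set: for two vertices \<open>u\<close>, \<open>v\<close> it
  contains the edge \<open>{u, v}\<close> twice.
\<close>

definition cycle_edges :: "'a list \<Rightarrow> 'a set list" where
  "cycle_edges vs = map (\<lambda>j. {vs ! j, vs ! (Suc j mod length vs)}) [0..<length vs]"

text \<open>
  Length 2 is allowed and means two copies of a single edge; whether both copies are
  available is decided by \<open>rainbow\<close>. From length 3 on this is the usual notion of a cycle in
  a simple graph.
\<close>

definition graph_cycle :: "'a set set \<Rightarrow> 'a list \<Rightarrow> bool" where
  "graph_cycle E vs \<longleftrightarrow> 2 \<le> length vs \<and> distinct vs \<and> set (cycle_edges vs) \<subseteq> E"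

text \<open>
  The edges are chosen from members of the family with pairwise distinct indices in \<open>I\<close>.
  An edge occurring twice in the list has to be chosen from two members of the family; for
  lists without repetition this says that the set of edges is rainbow.
\<close>

definition rainbow :: "'i set \<Rightarrow> ('i \<Rightarrow> 'e set) \<Rightarrow> 'e list \<Rightarrow> bool" where
  "rainbow I F es \<longleftrightarrow>
     (\<exists>ks. distinct ks \<and> set ks \<subseteq> I \<and> list_all2 (\<lambda>k e. e \<in> F k) ks es)"

definition rainbow_cycle :: "'a set set \<Rightarrow> 'i set \<Rightarrow> ('i \<Rightarrow> 'a set set) \<Rightarrow> 'a list \<Rightarrow> bool" where
  "rainbow_cycle E I F vs \<longleftrightarrow> graph_cycle E vs \<and> rainbow I F (cycle_edges vs)"

end

theory Submission
  imports Defs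
begin

text \<open>
  Instead of cycles we look for a nonempty set of at most \<open>B\<close> colours, with a chosen edge for
  each, whose edges cover at most as many vertices as there are colours; such a set contains a
  cycle, and this notion lifts through contractions without any case analysis on cycles.

  Let \<open>a\<close> be the number of colours with a single edge. The claimed bound is then
  \<open>\<lceil>(n + a) / 2\<rceil>\<close>, and it is proved by induction on \<open>n\<close> together with two relatives: the bound
  \<open>\<lfloor>(n + a) / 2\<rfloor>\<close> if \<open>a \<ge> 1\<close>, and \<open>\<lfloor>(n + a - 2) / 2\<rfloor>\<close> for \<open>n + 1\<close> colours and \<open>a \<ge> 3\<close>.
  For \<open>n + 2\<close> colours any choice of edges has two edge-disjoint cycles or a subdivision of
  \<open>K\<^sub>4\<close>, so a cycle of length at most \<open>(n + 2) / 2\<close>.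

  Deleting a vertex \<open>v\<close> kills the colours all of whose edges contain \<open>v\<close> and makes single those
  that lose one of two edges. In a minimal counterexample no deletion may lead to a smaller
  instance with a good bound; this forces degree at least 4 at every vertex, unless all
  obstructing vertices carry single colours, and those can be contracted. As the degrees sum to
  \<open>4n - 2a\<close> (or \<open>4n + 4 - 2a\<close>), only a few tight configurations remain.
\<close>

section \<open>Coloured families and short dense sets\<close>

definition coloured :: "'a set \<Rightarrow> 'i set \<Rightarrow> ('i \<Rightarrow> 'a set set) \<Rightarrow> bool" where
  "coloured V I F \<longleftrightarrow> finite V \<and> finite I \<and>
     (\<forall>i\<in>I. F i \<noteq> {} \<and> card (F i) \<le> 2 \<and> (\<forall>e\<in>F i. e \<subseteq> V \<and> card e = 2))"

text \<open>Indexing the chosen edges by colours lets an edge common to two colours be used twice: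
  these two colours cover only its two ends, which is the cycle of length 2.\<close>

definition short :: "'i set \<Rightarrow> ('i \<Rightarrow> 'a set set) \<Rightarrow> nat \<Rightarrow> bool" where
  "short I F B \<longleftrightarrow> (\<exists>J e. J \<subseteq> I \<and> finite J \<and> J \<noteq> {} \<and> card J \<le> B \<and>
     (\<forall>j\<in>J. e j \<in> F j) \<and> card (\<Union>j\<in>J. e j) \<le> card J)"

lemma short_mono:
  assumes "short I' F' B'" "I' \<subseteq> I" "\<And>i. i \<in> I' \<Longrightarrow> F' i \<subseteq> F i" "B' \<le> B"
  shows "short I F B"
proof -
  obtain J e where "J \<subseteq> I'" "finite J" "J \<noteq> {}" "card J \<le> B'"
     "\<forall>j\<in>J. e j \<in> F' j" "card (\<Union>j\<in>J. e j) \<le> card J"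
    using assms(1) unfolding short_def by blast
  with assms(2-4) show ?thesis unfolding short_def
    by (intro exI[of _ J] exI[of _ e]) (meson order_trans subsetD)
qed

lemma coloured_finite:
  assumes "coloured V I F" "i \<in> I"
  shows "finite (F i)"
proof (rule finite_subset)
  show "F i \<subseteq> Pow V" using assms unfolding coloured_def by auto
  show "finite (Pow V)" using assms unfolding coloured_def by auto
qed

lemma coloured_subset:
  assumes "coloured V I F" "I' \<subseteq> I"
  shows "coloured V I' F"
  using assms unfolding coloured_def by (auto intro: finite_subset)

lemma coloured_card:
  assumes "coloured V I F" "i \<in> I"
  shows "card (F i) = 1 \<or> card (F i) = 2"
proof -
  have "card (F i) \<noteq> 0" using coloured_finite[OF assms] assms unfolding coloured_def by auto
  moreover have "card (F i) \<le> 2" using assms unfolding coloured_def by auto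
  ultimately show ?thesis by linarith
qed

lemma card_2_other:
  assumes "card e = 2" "v \<in> e"
  obtains u where "e = {v, u}" "u \<noteq> v"
  using assms by (metis card_2_iff insert_commute insert_iff singletonD)

section \<open>Graphs with two more edges than vertices\<close>

text \<open>Weights stand for lengths of paths suppressed to one edge, and sets of size 1 for loops
  created on the way. Vertices of degree at most 1 are deleted and those of degree 2 suppressed
  until there is a loop or a parallel pair, or the graph is \<open>K\<^sub>4\<close>.\<close>

lemma weighted_dense_part:
  fixes w :: "'i \<Rightarrow> nat"
  assumes "finite V" "finite I" "card I = card V + 2"
    and "\<And>i. i \<in> I \<Longrightarrow> e i \<subseteq> V \<and> e i \<noteq> {} \<and> card (e i) \<le> 2"
  shows "\<exists>J\<subseteq>I. J \<noteq> {} \<and> card (\<Union>j\<in>J. e j) \<le> card J \<and> 2 * sum w J \<le> sum w I"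
  using assms
proof (induction "card V" arbitrary: V I e w rule: less_induct)
  case less
  note fin = less.prems(1,2) and cI = less.prems(3) and edge = less.prems(4)
  show ?case
  proof (cases "\<exists>J\<subseteq>I. J \<noteq> {} \<and> card J \<le> 2 \<and> card (\<Union>j\<in>J. e j) \<le> card J")
    case True
    \<comment> \<open>Removing at most two edges leaves at least \<open>card V\<close>, so
      \<open>J\<close> and \<open>I - J\<close> are both dense, and the lighter one has at most half
      of the weight.\<close>
    then obtain J where J: "J \<subseteq> I" "J \<noteq> {}" "card J \<le> 2" "card (\<Union>j\<in>J. e j) \<le> card J" by blast
    have fJ: "finite J" using J fin finite_subset by blast
    have c: "card (I - J) = card I - card J" using J fJ by (simp add: card_Diff_subset)
    have "card (\<Union>j\<in>I-J. e j) \<le> card V" using edge fin by (intro card_mono) auto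
    then have u: "card (\<Union>j\<in>I-J. e j) \<le> card (I - J)" using c cI J by linarith
    have "card V \<noteq> 0" using J edge fin by fastforce
    then have "card (I - J) \<noteq> 0" using c cI J by linarith
    then have ne2: "I - J \<noteq> {}" by (metis card.empty)
    have "sum w I = sum w J + sum w (I - J)"
      using sum.subset_diff[OF J(1) fin(2), of w] by simp
    then have "2 * sum w J \<le> sum w I \<or> 2 * sum w (I - J) \<le> sum w I" by linarith
    then show ?thesis using J u ne2 by blast
  next
    case False
    have c2: "card (e i) = 2" if "i \<in> I" for i
    proof -
      have "\<not> card (\<Union>j\<in>{i}. e j) \<le> card {i}" using False that by (intro notI, elim notE) (intro exI[of _ "{i}"], auto)
      then show ?thesis using edge[OF that] by auto
    qed
    have inj: "inj_on e I"
    proof (rule inj_onI, rule ccontr)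
      fix i j assume ij: "i \<in> I" "j \<in> I" "e i = e j" "i \<noteq> j"
      have "card (\<Union>k\<in>{i,j}. e k) \<le> card {i,j}" using ij c2 by auto
      then show False using False ij by (elim notE, intro exI[of _ "{i,j}"]) auto
    qed
    define D where "D v = {i \<in> I. v \<in> e i}" for v
    have fD: "finite (D v)" for v unfolding D_def using fin by auto
    consider (lo) v where "v \<in> V" "card (D v) \<le> 1" | (two) v where "v \<in> V" "card (D v) = 2"
      | (hi) "\<forall>v\<in>V. card (D v) \<ge> 3"
      by (metis One_nat_def Suc_1 le_antisym not_less_eq_eq numeral_3_eq_3)
    then show ?thesis
    proof cases
      case lo
      have "I \<noteq> {}" using cI by auto
      \<comment> \<open>If \<open>v\<close> is isolated, an arbitrary edge is given up with it, so
        that the excess stays two.\<close>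
      have "\<exists>i\<in>I. D v \<subseteq> {i}"
      proof (cases "D v = {}")
        case True then show ?thesis using \<open>I \<noteq> {}\<close> by auto
      next
        case F: False
        then have "card (D v) = 1" using lo fD[of v] by (metis card_0_eq le_antisym less_one linorder_not_less)
        then obtain i where "D v = {i}" by (auto simp: card_1_singleton_iff)
        then show ?thesis using D_def by blast
      qed
      then obtain i where i: "i \<in> I" "D v \<subseteq> {i}" by blast
      have pos: "card V > 0" using lo fin by (auto simp: card_gt_0_iff)
      have "\<exists>J\<subseteq>I-{i}. J \<noteq> {} \<and> card (\<Union>j\<in>J. e j) \<le> card J \<and> 2 * sum w J \<le> sum w (I-{i})"
      proof (rule less.hyps[of "V - {v}"])
        show "card (V-{v}) < card V" using lo fin by (intro card_Diff1_less)
        show "card (I - {i}) = card (V - {v}) + 2" using cI lo i pos by simp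
        show "e k \<subseteq> V - {v} \<and> e k \<noteq> {} \<and> card (e k) \<le> 2" if "k \<in> I - {i}" for k
          using that edge[of k] i D_def by blast
      qed (use fin in auto)
      moreover have "sum w (I-{i}) \<le> sum w I" using fin by (intro sum_mono2) auto
      ultimately show ?thesis by (meson Diff_subset dual_order.trans)
    next
      case two
      then obtain i j where ij: "D v = {i,j}" "i \<noteq> j" by (auto simp: card_2_iff)
      then have I: "i \<in> I" "j \<in> I" "v \<in> e i" "v \<in> e j" unfolding D_def by auto
      obtain p where p: "e i = {v,p}" "p \<noteq> v" using c2[of i] I card_2_other by metis
      obtain q where q: "e j = {v,q}" "q \<noteq> v" using c2[of j] I card_2_other by metis
      have pq: "p \<in> V" "q \<in> V" using p q edge I by blast+
      have pos: "card V > 0" using two fin by (auto simp: card_gt_0_iff)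
      \<comment> \<open>Contract \<open>e i\<close>; since \<open>v\<close> has degree 2, a cycle through \<open>e j\<close> also uses \<open>e i\<close>,
        so \<open>j\<close> takes over the weight of \<open>i\<close>. This may create a loop \<open>{p}\<close>.\<close>
      define e' where "e' = e(j := {p,q})"
      define w' where "w' = w(j := w i + w j)"
      have "\<exists>J\<subseteq>I-{i}. J \<noteq> {} \<and> card (\<Union>j\<in>J. e' j) \<le> card J \<and> 2 * sum w' J \<le> sum w' (I-{i})"
      proof (rule less.hyps[of "V - {v}"])
        show "card (V-{v}) < card V" using two fin by (intro card_Diff1_less)
        show "card (I - {i}) = card (V - {v}) + 2" using cI two I pos by simp
        show "e' k \<subseteq> V - {v} \<and> e' k \<noteq> {} \<and> card (e' k) \<le> 2" if "k \<in> I - {i}" for k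
        proof (cases "k = j")
          case True
          then show ?thesis using pq p q by (auto simp: e'_def card_insert_if)
        next
          case False
          then have "v \<notin> e k" using that ij D_def by blast
          then show ?thesis using that edge[of k] False by (auto simp: e'_def)
        qed
      qed (use fin in auto)
      then obtain J where J: "J \<subseteq> I - {i}" "J \<noteq> {}" "card (\<Union>j\<in>J. e' j) \<le> card J"
         "2 * sum w' J \<le> sum w' (I-{i})" by blast
      have fJ: "finite J" using J fin finite_subset by (metis finite_Diff)
      have S: "sum w (insert i K) = sum w' K" if "j \<in> K" "finite K" "i \<notin> K" for K
      proof -
        have "sum w' K = w' j + sum w' (K - {j})" using that by (simp add: sum.remove)
        also have "sum w' (K-{j}) = sum w (K-{j})" by (rule sum.cong) (auto simp: w'_def)
        also have "w' j + sum w (K-{j}) = w i + sum w K" using that by (simp add: w'_def sum.remove)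
        finally show ?thesis using that by simp
      qed
      have SI: "sum w I = sum w' (I - {i})"
        using S[of "I-{i}"] fin ij I by (simp add: insert_absorb)
      show ?thesis
      proof (cases "j \<in> J")
        case True
        have "(\<Union>k\<in>insert i J. e k) \<subseteq> insert v (\<Union>k\<in>J. e' k)"
          using True p q by (auto simp: e'_def)
        moreover have fU: "finite (\<Union>k\<in>J. e' k)"
        proof (rule finite_subset[of _ V])
          show "(\<Union>k\<in>J. e' k) \<subseteq> V"
          proof (rule UN_least)
            fix k assume "k \<in> J"
            then have "k \<in> I" using J by auto
            then show "e' k \<subseteq> V" using edge[of k] pq by (auto simp: e'_def)
          qed
        qed (use fin in auto)
        ultimately have "card (\<Union>k\<in>insert i J. e k) \<le> card (insert v (\<Union>k\<in>J. e' k))"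
          by (intro card_mono) auto
        also have "\<dots> \<le> Suc (card (\<Union>k\<in>J. e' k))" using fU by (simp add: card_insert_if)
        also have "\<dots> \<le> card (insert i J)" using J fJ by (subst card_insert_disjoint) auto
        finally have "card (\<Union>k\<in>insert i J. e k) \<le> card (insert i J)" .
        moreover have "sum w (insert i J) = sum w' J" using S[of J] True fJ J(1) by blast
        then have "2 * sum w (insert i J) \<le> sum w I" using J(4) SI by simp
        ultimately show ?thesis using J I by (intro exI[of _ "insert i J"]) auto
      next
        case F: False
        have "(\<Union>k\<in>J. e k) = (\<Union>k\<in>J. e' k)" using F by (auto simp: e'_def)
        moreover have "sum w J = sum w' J" using F by (intro sum.cong) (auto simp: w'_def)
        ultimately show ?thesis using J SI by (intro exI[of _ J]) auto
      qed
    next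
      case hi
      have "(\<Sum>v\<in>V. card (D v)) = (\<Sum>v\<in>V. \<Sum>i\<in>I. if v \<in> e i then 1 else 0)"
        unfolding D_def using fin by (intro sum.cong) (auto simp: sum.If_cases Int_def)
      also have "\<dots> = (\<Sum>i\<in>I. \<Sum>v\<in>V. if v \<in> e i then 1 else 0)" by (rule sum.swap)
      also have "\<dots> = (\<Sum>i\<in>I. 2)"
      proof (rule sum.cong)
        fix i assume i: "i \<in> I"
        have "V \<inter> e i = e i" using edge i by auto
        then show "(\<Sum>v\<in>V. if v \<in> e i then 1 else 0) = (2::nat)"
          using fin c2[OF i] by (simp add: sum.If_cases Int_def)
      qed simp
      finally have deg: "(\<Sum>v\<in>V. card (D v)) = 2 * (card V + 2)" using cI by simp
      have "V \<noteq> {}"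
      proof
        assume "V = {}"
        moreover have "I \<noteq> {}" using cI by auto
        ultimately show False using edge by auto
      qed
      then obtain v0 where v0: "v0 \<in> V" by auto
      have bound: "card (D v) \<le> card V - 1" if "v \<in> V" for v
      proof -
        have "e ` D v \<subseteq> (\<lambda>u. {v,u}) ` (V - {v})"
        proof
          fix x assume "x \<in> e ` D v"
          then obtain i where i: "i \<in> I" "v \<in> e i" "x = e i" unfolding D_def by auto
          then obtain u where "e i = {v,u}" "u \<noteq> v" using c2[of i] card_2_other by metis
          then show "x \<in> (\<lambda>u. {v,u}) ` (V - {v})" using i edge by auto
        qed
        then have "card (e ` D v) \<le> card ((\<lambda>u. {v,u}) ` (V - {v}))" using fin by (intro card_mono) auto
        also have "\<dots> \<le> card (V - {v})" using fin by (intro card_image_le) auto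
        also have "card (e ` D v) = card (D v)"
          using inj unfolding D_def by (intro card_image) (auto intro: inj_on_subset)
        finally show ?thesis using that by simp
      qed
      \<comment> \<open>Minimum degree 3 gives \<open>3 * card V \<le> 2 * (card V + 2)\<close>, so
        there are at most four vertices; without loops and parallel edges a vertex of degree 3 has
        three neighbours, so there are at least four.\<close>
      have "3 * card V \<le> (\<Sum>v\<in>V. card (D v))"
        using hi sum_mono[of V "\<lambda>_. 3" "\<lambda>v. card (D v)"] by simp
      then have "card V \<le> 4" using deg by simp
      moreover have "card V \<ge> 4" using bound[OF v0] hi v0 by fastforce
      ultimately have V4: "card V = 4" by simp
      have D3: "card (D v) = 3" if "v \<in> V" for v using bound[OF that] hi that V4 by fastforce
      \<comment> \<open>Now the graph is \<open>K\<^sub>4\<close>, and its four triangles \<open>A v\<close> cover every edge twice.\<close>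
      define A where "A v = I - D v" for v
      have cA: "card (A v) = 3" if "v \<in> V" for v
      proof -
        have "D v \<subseteq> I" unfolding D_def by auto
        then show ?thesis unfolding A_def using D3[OF that] cI V4 fD[of v] by (simp add: card_Diff_subset)
      qed
      have uA: "card (\<Union>j\<in>A v. e j) \<le> card (A v)" if "v \<in> V" for v
      proof -
        have "(\<Union>j\<in>A v. e j) \<subseteq> V - {v}" using edge unfolding A_def D_def by fastforce
        then have "card (\<Union>j\<in>A v. e j) \<le> card (V - {v})" using fin by (intro card_mono) auto
        then show ?thesis using that V4 cA by simp
      qed
      have "(\<Sum>v\<in>V. sum w (A v)) = (\<Sum>v\<in>V. \<Sum>i\<in>I. if v \<notin> e i then w i else 0)"
      proof (rule sum.cong)
        fix v
        have "A v = {i \<in> I. v \<notin> e i}" unfolding A_def D_def by auto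
        then show "sum w (A v) = (\<Sum>i\<in>I. if v \<notin> e i then w i else 0)"
          using fin by (simp only: sum.inter_filter)
      qed simp
      also have "\<dots> = (\<Sum>i\<in>I. \<Sum>v\<in>V. if v \<notin> e i then w i else 0)" by (rule sum.swap)
      also have "\<dots> = (\<Sum>i\<in>I. 2 * w i)"
      proof (rule sum.cong)
        fix i assume i: "i \<in> I"
        have "card {v \<in> V. v \<notin> e i} = card (V - e i)" by (rule arg_cong[of _ _ card]) auto
        also have "\<dots> = 2"
          using edge[OF i] c2[OF i] V4 fin by (subst card_Diff_subset) (auto intro: finite_subset)
        finally show "(\<Sum>v\<in>V. if v \<notin> e i then w i else 0) = 2 * w i"
          using fin by (simp add: sum.If_cases Int_def)
      qed simp
      finally have tot: "(\<Sum>v\<in>V. sum w (A v)) = 2 * sum w I" by (simp add: sum_distrib_left)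
      \<comment> \<open>The four weights add up to twice the total, so the lightest triangle has at
        most half of it.\<close>
      have "\<exists>v\<in>V. 2 * sum w (A v) \<le> sum w I"
      proof (rule ccontr)
        assume "\<not> ?thesis"
        then have "\<And>v. v \<in> V \<Longrightarrow> sum w I < 2 * sum w (A v)" by force
        then have "(\<Sum>v\<in>V. sum w I) < (\<Sum>v\<in>V. 2 * sum w (A v))"
          using fin v0 by (intro sum_strict_mono) auto
        then show False using tot V4 by (simp add: sum_distrib_left[symmetric])
      qed
      then obtain v where v: "v \<in> V" "2 * sum w (A v) \<le> sum w I" by blast
      moreover have "A v \<noteq> {}" using cA[OF v(1)] by auto
      ultimately show ?thesis using uA[OF v(1)] by (intro exI[of _ "A v"]) (auto simp: A_def)
    qed
  qed
qed

text \<open>Any choice of one edge per colour will do; unit weights turn half of the weight into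
  half of \<open>card V + 2\<close>.\<close>

lemma short_excess_two:
  assumes "coloured V I F" "card I = card V + 2"
  shows "short I F ((card V + 2) div 2)"
proof -
  define e where "e i = (SOME x. x \<in> F i)" for i
  have e: "e i \<in> F i" if "i \<in> I" for i
    using that assms(1) unfolding e_def coloured_def by (meson ex_in_conv someI_ex)
  have "\<exists>J\<subseteq>I. J \<noteq> {} \<and> card (\<Union>j\<in>J. e j) \<le> card J \<and> 2 * sum (\<lambda>_. 1::nat) J \<le> sum (\<lambda>_. 1) I"
  proof (rule weighted_dense_part[of V])
    show "e i \<subseteq> V \<and> e i \<noteq> {} \<and> card (e i) \<le> 2" if "i \<in> I" for i
      using e[OF that] assms(1) that unfolding coloured_def by fastforce
  qed (use assms in \<open>auto simp: coloured_def\<close>)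
  then obtain J where J: "J \<subseteq> I" "J \<noteq> {}" "card (\<Union>j\<in>J. e j) \<le> card J" "2 * card J \<le> card I"
    by auto
  moreover have "finite J" using J assms finite_subset unfolding coloured_def by blast
  ultimately show ?thesis unfolding short_def using assms(2) e
    by (intro exI[of _ J] exI[of _ e]) auto
qed

section \<open>Extracting a cycle\<close>

text \<open>A vertex lying on only one edge is discarded together with that edge, which keeps the
  density. Once every covered vertex has degree at least 2, a longest path closes up at its first
  vertex.\<close>

lemma cycle_of_dense_part:
  assumes "finite J" "J \<noteq> {}" "\<And>j. j \<in> J \<Longrightarrow> card (e j) = 2" "card (\<Union>j\<in>J. e j) \<le> card J"
  shows "\<exists>vs ks. 2 \<le> length vs \<and> length vs \<le> card J \<and> distinct vs \<and> distinct ks \<and> set ks \<subseteq> J \<and>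
           list_all2 (\<lambda>k d. d = e k) ks (cycle_edges vs)"
  using assms
proof (induction "card J" arbitrary: J rule: less_induct)
  case less
  note fJ = less.prems(1) and c2 = less.prems(3)
  define U where "U = (\<Union>j\<in>J. e j)"
  have fU: "finite U" unfolding U_def using fJ c2 by (auto intro!: finite_UN_I card_ge_0_finite)
  have U2: "card U \<ge> 2"
  proof -
    obtain j where j: "j \<in> J" using less.prems(2) by auto
    then have "e j \<subseteq> U" unfolding U_def by auto
    then show ?thesis using c2[OF j] card_mono[OF fU] by metis
  qed
  show ?case
  proof (cases "\<exists>v i. i \<in> J \<and> v \<in> e i \<and> (\<forall>j\<in>J. v \<in> e j \<longrightarrow> j = i)")
    case True
    then obtain v i where vi: "i \<in> J" "v \<in> e i" "\<forall>j\<in>J. v \<in> e j \<longrightarrow> j = i" by blast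
    have "(\<Union>j\<in>J-{i}. e j) \<subseteq> U - {v}" using vi(3) unfolding U_def by blast
    then have "card (\<Union>j\<in>J-{i}. e j) \<le> card (U - {v})" using fU by (intro card_mono) auto
    moreover have "v \<in> U" using vi(1,2) unfolding U_def by blast
    ultimately have le: "card (\<Union>j\<in>J-{i}. e j) \<le> card U - 1" by simp
    have cJ: "card (J - {i}) = card J - 1" using vi(1) fJ by simp
    have cU: "card U \<le> card J" using less.prems(4) U_def by simp
    \<comment> \<open>\<open>U\<close> has at least two vertices, so \<open>J\<close> has at least
      two colours and one is left.\<close>
    have "card (J - {i}) \<noteq> 0" using cJ cU U2 by linarith
    then have ne: "J - {i} \<noteq> {}" by (metis card.empty)
    have "\<exists>vs ks. 2 \<le> length vs \<and> length vs \<le> card (J-{i}) \<and> distinct vs \<and> distinct ks \<and>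
        set ks \<subseteq> J-{i} \<and> list_all2 (\<lambda>k d. d = e k) ks (cycle_edges vs)"
      using less.hyps[of "J - {i}"] fJ vi(1) c2 ne le cJ cU card_Diff1_less[of J i] by auto
    then show ?thesis using cJ by (meson Diff_subset card_Diff1_le dual_order.trans)
  next
    case False
    \<comment> \<open>\<open>P\<close> describes a path with vertices \<open>vs\<close> whose
      consecutive edges have the colours \<open>ks\<close>.\<close>
    define P where "P = (\<lambda>(vs, ks). ks \<noteq> [] \<and> length vs = Suc (length ks) \<and> distinct vs \<and>
       set ks \<subseteq> J \<and> (\<forall>i<length ks. e (ks!i) = {vs!i, vs!Suc i}))"
    obtain j where j: "j \<in> J" using less.prems(2) by auto
    then obtain a b where ab: "e j = {a,b}" "a \<noteq> b" using c2 by (meson card_2_iff)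
    have P0: "P ([a,b],[j])" unfolding P_def using ab j by auto
    have setU: "set vs \<subseteq> U" if "P (vs, ks)" for vs ks
    proof
      fix v assume "v \<in> set vs"
      then obtain m where m: "m < length vs" "v = vs ! m" by (auto simp: in_set_conv_nth)
      obtain i where i: "i < length ks" "v \<in> {vs!i, vs!Suc i}"
      proof (cases m)
        case 0
        then show ?thesis using that[of 0] m \<open>P (vs, ks)\<close> unfolding P_def by auto
      next
        case (Suc m')
        then show ?thesis using that[of m'] m \<open>P (vs, ks)\<close> unfolding P_def by auto
      qed
      then have "v \<in> e (ks!i)" "ks!i \<in> J" using \<open>P (vs, ks)\<close> unfolding P_def by auto
      then show "v \<in> U" unfolding U_def by auto
    qed
    have "\<forall>y. P y \<longrightarrow> length (fst y) < Suc (card U)"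
    proof (intro allI impI)
      fix y assume y: "P y"
      obtain vs ks where [simp]: "y = (vs, ks)" by force
      have "length vs = card (set vs)" using y unfolding P_def by (simp add: distinct_card)
      also have "\<dots> \<le> card U" using setU y fU by (intro card_mono) auto
      finally show "length (fst y) < Suc (card U)" by simp
    qed
    from ex_has_greatest_nat[of P, OF P0 this]
    obtain vs ks where max: "P (vs, ks)" "\<And>vs' ks'. P (vs', ks') \<Longrightarrow> length vs' \<le> length vs"
      by fastforce
    have vk: "ks \<noteq> []" "length vs = Suc (length ks)" "distinct vs" "set ks \<subseteq> J"
      and ek: "\<And>i. i < length ks \<Longrightarrow> e (ks!i) = {vs!i, vs!Suc i}"
      using max(1) unfolding P_def by auto
    have "ks!0 \<in> J" "vs!0 \<in> e (ks!0)" using vk ek[of 0] by auto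
    \<comment> \<open>The first vertex lies on a second edge; as the path is longest, the other end
      \<open>u\<close> of that edge is already on the path.\<close>
    then obtain k where k: "k \<in> J" "vs!0 \<in> e k" "k \<noteq> ks!0" using False by blast
    then obtain u where u: "e k = {vs!0, u}" "u \<noteq> vs!0" using c2 card_2_other by metis
    have "u \<in> set vs"
    proof (rule ccontr)
      assume "u \<notin> set vs"
      moreover have "e ((k#ks)!i) = {(u#vs)!i, (u#vs)!Suc i}" if "i < length (k#ks)" for i
        using that u ek by (cases i) (auto simp: insert_commute)
      ultimately have "P (u # vs, k # ks)" unfolding P_def using vk k by simp
      from max(2)[OF this] show False by simp
    qed
    then obtain m where m: "m < length vs" "u = vs ! m" by (auto simp: in_set_conv_nth)
    then have m0: "m > 0" using u by (cases m) auto
    \<comment> \<open>The edge of \<open>k\<close> closes the initial segment ending in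
      \<open>u\<close>. For \<open>m = 1\<close> it is parallel to the first edge and the cycle has
      length 2.\<close>
    define cs where "cs = take (Suc m) vs"
    define js where "js = take m ks @ [k]"
    have lcs: "length cs = Suc m" and ljs: "length js = Suc m" using m vk by (auto simp: cs_def js_def)
    have vsinj: "vs!i = vs!i' \<longleftrightarrow> i = i'" if "i < length vs" "i' < length vs" for i i'
      using nth_eq_iff_index_eq[OF vk(3) that] .
    have dks: "distinct ks"
      unfolding distinct_conv_nth
    proof (intro allI impI)
      fix i i' assume i: "i < length ks" "i' < length ks" "i \<noteq> i'"
      show "ks!i \<noteq> ks!i'"
      proof
        assume "ks!i = ks!i'"
        then have "{vs!i, vs!Suc i} = {vs!i', vs!Suc i'}" using ek i by metis
        then show False using i vk vsinj by (auto simp: doubleton_eq_iff)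
      qed
    qed
    have kn: "k \<notin> set ks"
    proof
      assume "k \<in> set ks"
      then obtain i where i: "i < length ks" "k = ks!i" by (auto simp: in_set_conv_nth)
      then have "i \<noteq> 0" using k by (metis)
      moreover have "vs!0 \<in> {vs!i, vs!Suc i}" using ek i k by auto
      ultimately show False using vsinj i vk by auto
    qed
    have djs: "distinct js" using dks kn unfolding js_def by (auto dest: in_set_takeD)
    have sjs: "set js \<subseteq> J" using vk k unfolding js_def by (auto dest: in_set_takeD)
    have "list_all2 (\<lambda>k d. d = e k) js (cycle_edges cs)"
      unfolding list_all2_conv_all_nth
    proof (intro conjI allI impI)
      show "length js = length (cycle_edges cs)" using lcs ljs by (simp add: cycle_edges_def)
      fix i assume i: "i < length js"
      have *: "cycle_edges cs ! i = {cs!i, cs!(Suc i mod Suc m)}"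
        using i lcs ljs by (simp add: cycle_edges_def del: upt_Suc)
      show "cycle_edges cs ! i = e (js!i)"
      proof (cases "i < m")
        case True
        then have "cs!(Suc i mod Suc m) = vs!Suc i" "cs!i = vs!i" "js!i = ks!i"
          using m vk by (auto simp: cs_def js_def nth_append)
        then show ?thesis using * ek[of i] True m vk by simp
      next
        case F: False
        then have im: "i = m" using i ljs by simp
        have "cs!(Suc i mod Suc m) = vs!0" "cs!i = vs!m" "js!i = k"
          using m vk im by (auto simp: cs_def js_def nth_append)
        then show ?thesis using * u m by (simp add: insert_commute)
      qed
    qed
    moreover have "length cs \<le> card J"
      using djs sjs fJ lcs ljs card_mono[OF fJ sjs] by (simp add: distinct_card)
    moreover have "distinct cs" using vk by (simp add: cs_def)
    ultimately show ?thesis using lcs m0 djs sjs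
      by (intro exI[of _ cs] exI[of _ js]) simp
  qed
qed

lemma rainbow_cycle_of_short:
  assumes "coloured V I F" "short I F B" "\<And>i. i \<in> I \<Longrightarrow> F i \<subseteq> E"
  shows "\<exists>vs. rainbow_cycle E I F vs \<and> length vs \<le> B"
proof -
  obtain J e where J: "J \<subseteq> I" "finite J" "J \<noteq> {}" "card J \<le> B"
     "\<forall>j\<in>J. e j \<in> F j" "card (\<Union>j\<in>J. e j) \<le> card J"
    using assms(2) unfolding short_def by blast
  have "\<And>j. j \<in> J \<Longrightarrow> card (e j) = 2" using J assms(1) unfolding coloured_def by blast
  from cycle_of_dense_part[OF J(2,3) this J(6)]
  obtain vs ks where v: "2 \<le> length vs" "length vs \<le> card J" "distinct vs" "distinct ks" "set ks \<subseteq> J"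
    "list_all2 (\<lambda>k d. d = e k) ks (cycle_edges vs)" by auto
  have "list_all2 (\<lambda>k d. d \<in> F k) ks (cycle_edges vs)"
    using v(6) by (rule list.rel_mono_strong) (use v(5) J(5) in auto)
  moreover have "set (cycle_edges vs) \<subseteq> E"
  proof
    fix d assume "d \<in> set (cycle_edges vs)"
    then obtain i where i: "i < length (cycle_edges vs)" "d = cycle_edges vs ! i"
      by (auto simp: in_set_conv_nth)
    then have "d = e (ks!i)" "ks!i \<in> set ks" using v(6) by (auto simp: list_all2_conv_all_nth)
    then show "d \<in> E" using v(5) J assms(3) by blast
  qed
  ultimately show ?thesis using v J
    unfolding rainbow_cycle_def graph_cycle_def rainbow_def by (intro exI[of _ vs]) auto
qed

section \<open>Deletion, contraction and degrees\<close>

definition singles :: "'i set \<Rightarrow> ('i \<Rightarrow> 'a set set) \<Rightarrow> 'i set" where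
  "singles I F = {i \<in> I. card (F i) = 1}"

definition stars :: "'i set \<Rightarrow> ('i \<Rightarrow> 'a set set) \<Rightarrow> 'a \<Rightarrow> 'i set" where
  "stars I F v = {i \<in> I. card (F i) = 2 \<and> (\<forall>e\<in>F i. v \<in> e)}"

definition singles_at :: "'i set \<Rightarrow> ('i \<Rightarrow> 'a set set) \<Rightarrow> 'a \<Rightarrow> 'i set" where
  "singles_at I F v = {i \<in> I. card (F i) = 1 \<and> (\<forall>e\<in>F i. v \<in> e)}"

definition halves :: "'i set \<Rightarrow> ('i \<Rightarrow> 'a set set) \<Rightarrow> 'a \<Rightarrow> 'i set" where
  "halves I F v = {i \<in> I. card (F i) = 2 \<and> (\<exists>e\<in>F i. v \<in> e) \<and> (\<exists>e\<in>F i. v \<notin> e)}"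

definition deleted :: "'a \<Rightarrow> ('i \<Rightarrow> 'a set set) \<Rightarrow> 'i \<Rightarrow> 'a set set" where
  "deleted v F i = {e \<in> F i. v \<notin> e}"

definition survivors :: "'i set \<Rightarrow> ('i \<Rightarrow> 'a set set) \<Rightarrow> 'a \<Rightarrow> 'i set" where
  "survivors I F v = I - (stars I F v \<union> singles_at I F v)"

lemma coloured_finite_sets:
  assumes "coloured V I F"
  shows "finite (singles I F)" "finite (stars I F v)" "finite (singles_at I F v)"
    "finite (halves I F v)" "finite (survivors I F v)"
  using assms unfolding coloured_def singles_def stars_def singles_at_def halves_def survivors_def
  by auto

lemma survivors_card:
  assumes "coloured V I F"
  shows "card (survivors I F v) + card (stars I F v) + card (singles_at I F v) = card I"
proof -
  have "I = survivors I F v \<union> (stars I F v \<union> singles_at I F v)"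
    unfolding survivors_def stars_def singles_at_def by auto
  then have "card I = card (survivors I F v) + card (stars I F v \<union> singles_at I F v)"
    using coloured_finite_sets[OF assms] by (metis card_Un_disjoint Diff_disjoint Int_commute finite_UnI survivors_def)
  also have "card (stars I F v \<union> singles_at I F v) = card (stars I F v) + card (singles_at I F v)"
    using coloured_finite_sets[OF assms] by (intro card_Un_disjoint) (auto simp: stars_def singles_at_def)
  finally show ?thesis by simp
qed

lemma survivors_deleted:
  assumes "coloured V I F"
  shows "survivors I F v = {i \<in> I. deleted v F i \<noteq> {}}"
  using coloured_card[OF assms] unfolding survivors_def stars_def singles_at_def deleted_def by auto

lemma deleted_coloured:
  assumes "coloured V I F"
  shows "coloured (V - {v}) (survivors I F v) (deleted v F)"
proof -
  have "card (deleted v F i) \<le> 2" if "i \<in> I" for i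
  proof -
    have "card (deleted v F i) \<le> card (F i)"
      unfolding deleted_def using coloured_finite[OF assms that] by (intro card_mono) auto
    then show ?thesis using assms that unfolding coloured_def by (meson order_trans)
  qed
  then show ?thesis using assms unfolding survivors_deleted[OF assms]
    unfolding coloured_def deleted_def by auto
qed

lemma deleted_short:
  assumes "short (survivors I F v) (deleted v F) B'" "B' \<le> B"
  shows "short I F B"
  using assms by (rule_tac short_mono) (auto simp: survivors_def deleted_def)

lemma halves_deleted:
  assumes "coloured V I F" "i \<in> I"
  shows "i \<in> halves I F v \<longleftrightarrow> card (F i) = 2 \<and> card (deleted v F i) = 1"
proof -
  have *: "card {x \<in> {a,b}. v \<notin> x} = 1 \<longleftrightarrow> (v \<in> a \<and> v \<notin> b) \<or> (v \<notin> a \<and> v \<in> b)" if "a \<noteq> b" for a b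
  proof -
    have "{x \<in> {a,b}. v \<notin> x} = (if v \<in> a then {} else {a}) \<union> (if v \<in> b then {} else {b})" by auto
    then show ?thesis using that by auto
  qed
  show ?thesis
  proof (cases "card (F i) = 2")
    case True
    then obtain a b where ab: "F i = {a,b}" "a \<noteq> b" by (auto simp: card_2_iff)
    show ?thesis using *[OF ab(2)] assms(2) ab unfolding halves_def deleted_def by auto
  next
    case False
    then show ?thesis unfolding halves_def by auto
  qed
qed

text \<open>Deletion of \<open>v\<close> removes the single colours at \<open>v\<close> and turns
  the halves into new ones. Sums on both sides avoid truncated subtraction.\<close>

lemma deleted_singles_card:
  assumes "coloured V I F"
  shows "card (singles (survivors I F v) (deleted v F)) + card (singles_at I F v)
       = card (singles I F) + card (halves I F v)"
proof -
  let ?S = "singles (survivors I F v) (deleted v F)"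
  have sub: "singles_at I F v \<subseteq> singles I F" unfolding singles_at_def singles_def by auto
  have "i \<in> ?S \<longleftrightarrow> i \<in> (singles I F - singles_at I F v) \<union> halves I F v" if i: "i \<in> I" for i
  proof (cases "card (F i) = 1")
    case True
    then obtain x where x: "F i = {x}" by (auto simp: card_1_singleton_iff)
    have "deleted v F i = (if v \<in> x then {} else {x})" using x unfolding deleted_def by auto
    then show ?thesis using i True x
      unfolding survivors_deleted[OF assms] singles_def singles_at_def halves_def by auto
  next
    case False
    then have "card (F i) = 2" using coloured_card[OF assms i] by auto
    then show ?thesis using halves_deleted[OF assms i, of v] i
      unfolding survivors_deleted[OF assms] singles_def singles_at_def by auto
  qed
  then have "?S = (singles I F - singles_at I F v) \<union> halves I F v"
    unfolding survivors_def singles_def singles_at_def halves_def by blast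
  then have "card ?S = card (singles I F - singles_at I F v) + card (halves I F v)"
    using coloured_finite_sets[OF assms]
    by (simp only:) (intro card_Un_disjoint, auto simp: singles_def halves_def)
  moreover have "card (singles I F - singles_at I F v) + card (singles_at I F v) = card (singles I F)"
    using sub coloured_finite_sets[OF assms] by (metis card_Diff_subset card_mono le_add_diff_inverse2)
  ultimately show ?thesis by linarith
qed

section \<open>Counting incidences and edges\<close>

text \<open>Double counting of incidences: a colour contributes \<open>2 * card (F i)\<close>, which
  is 4, or 2 for a single colour; the second summand makes up for the latter.\<close>

lemma degree_sum:
  assumes "coloured V I F"
  shows "(\<Sum>v\<in>V. 2 * card (stars I F v) + card (singles_at I F v) + card (halves I F v))
     + 2 * card (singles I F) = 4 * card I"
proof -
  have finI: "finite I" and finV: "finite V" using assms unfolding coloured_def by auto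
  have deg: "(\<Sum>i\<in>I. card {e \<in> F i. v \<in> e}) =
     2 * card (stars I F v) + card (singles_at I F v) + card (halves I F v)" for v
  proof -
    have "card {e \<in> F i. v \<in> e} = (if i \<in> stars I F v then 2 else 0) +
        (if i \<in> singles_at I F v then 1 else 0) + (if i \<in> halves I F v then 1 else 0)"
      if i: "i \<in> I" for i
    proof (cases "card (F i) = 1")
      case True
      then obtain x where x: "F i = {x}" by (auto simp: card_1_singleton_iff)
      have "{e \<in> F i. v \<in> e} = (if v \<in> x then {x} else {})" using x by auto
      then show ?thesis using x i unfolding stars_def singles_at_def halves_def by auto
    next
      case False
      then have "card (F i) = 2" using coloured_card[OF assms i] by auto
      then obtain a b where ab: "F i = {a,b}" "a \<noteq> b" by (auto simp: card_2_iff)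
      have "{e \<in> F i. v \<in> e} = (if v \<in> a then {a} else {}) \<union> (if v \<in> b then {b} else {})"
        using ab by auto
      then show ?thesis using ab i unfolding stars_def singles_at_def halves_def by auto
    qed
    then have "(\<Sum>i\<in>I. card {e \<in> F i. v \<in> e}) = (\<Sum>i\<in>I. (if i \<in> stars I F v then 2 else 0) +
        (if i \<in> singles_at I F v then 1 else 0) + (if i \<in> halves I F v then 1 else 0))"
      by (rule sum.cong[OF refl])
    moreover have "I \<inter> stars I F v = stars I F v" "I \<inter> singles_at I F v = singles_at I F v"
      "I \<inter> halves I F v = halves I F v" unfolding stars_def singles_at_def halves_def by auto
    ultimately show ?thesis using finI by (simp add: sum.distrib sum.If_cases)
  qed
  have "(\<Sum>v\<in>V. \<Sum>i\<in>I. card {e \<in> F i. v \<in> e}) = (\<Sum>i\<in>I. \<Sum>v\<in>V. card {e \<in> F i. v \<in> e})"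
    by (rule sum.swap)
  also have "\<dots> = (\<Sum>i\<in>I. 2 * card (F i))"
  proof (rule sum.cong)
    fix i assume i: "i \<in> I"
    have f: "finite (F i)" using coloured_finite[OF assms i] .
    have "(\<Sum>v\<in>V. card {e \<in> F i. v \<in> e}) = (\<Sum>v\<in>V. \<Sum>e\<in>F i. if v \<in> e then 1 else 0)"
      using f by (intro sum.cong) (auto simp: sum.If_cases Int_def)
    also have "\<dots> = (\<Sum>e\<in>F i. \<Sum>v\<in>V. if v \<in> e then 1 else 0)" by (rule sum.swap)
    also have "\<dots> = (\<Sum>e\<in>F i. 2)"
    proof (rule sum.cong)
      fix e assume "e \<in> F i"
      then have e: "e \<subseteq> V" "card e = 2" using assms i unfolding coloured_def by auto
      then have "V \<inter> e = e" by auto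
      then show "(\<Sum>v\<in>V. if v \<in> e then 1 else 0) = (2::nat)"
        using finV e by (simp add: sum.If_cases)
    qed simp
    finally show "(\<Sum>v\<in>V. card {e \<in> F i. v \<in> e}) = 2 * card (F i)" by simp
  qed simp
  also have "\<dots> + 2 * card (singles I F) = (\<Sum>i\<in>I. 2 * card (F i) + (if i \<in> singles I F then 2 else 0))"
  proof -
    have "I \<inter> singles I F = singles I F" unfolding singles_def by auto
    then show ?thesis using finI by (simp add: sum.distrib sum.If_cases)
  qed
  also have "\<dots> = (\<Sum>i\<in>I. 4)"
    using coloured_card[OF assms] by (intro sum.cong) (auto simp: singles_def)
  finally show ?thesis unfolding deg by simp
qed

text \<open>Two colours with a common edge cover only two vertices and would form a short
  set.\<close>

lemma not_short_disjoint:
  assumes "\<not> short I F B" "2 \<le> B" "i \<in> I" "j \<in> I" "e \<in> F i" "e \<in> F j" "card e = 2"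
  shows "i = j"
proof (rule ccontr)
  assume "i \<noteq> j"
  then have "short I F B" unfolding short_def using assms
    by (intro exI[of _ "{i,j}"] exI[of _ "\<lambda>_. e"]) auto
  then show False using assms by simp
qed

text \<open>Distinct colours share no edge, so their \<open>2 * card I - card (singles I F)\<close>
  edges are at most as many as the pairs of vertices. This excludes small vertex sets in the
  induction.\<close>

lemma not_short_card_edges:
  assumes "coloured V I F" "\<not> short I F B" "2 \<le> B"
  shows "2 * (2 * card I) \<le> 2 * card (singles I F) + card V * (card V - 1)"
proof -
  have finI: "finite I" and finV: "finite V" using assms unfolding coloured_def by auto
  have "2 * card I = (\<Sum>i\<in>I. card (F i) + (if i \<in> singles I F then 1 else 0))"
  proof -
    have "(\<Sum>i\<in>I. card (F i) + (if i \<in> singles I F then 1 else 0)) = (\<Sum>i\<in>I. 2)"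
      using coloured_card[OF assms(1)] by (intro sum.cong) (auto simp: singles_def)
    then show ?thesis by simp
  qed
  also have "\<dots> = (\<Sum>i\<in>I. card (F i)) + card (singles I F)"
  proof -
    have "I \<inter> singles I F = singles I F" unfolding singles_def by auto
    then show ?thesis using finI by (simp add: sum.distrib sum.If_cases)
  qed
  also have "(\<Sum>i\<in>I. card (F i)) = card (\<Union>i\<in>I. F i)"
  proof (rule card_UN_disjoint[symmetric])
    show "\<forall>i\<in>I. finite (F i)" using coloured_finite[OF assms(1)] by auto
    show "\<forall>i\<in>I. \<forall>j\<in>I. i \<noteq> j \<longrightarrow> F i \<inter> F j = {}"
      using not_short_disjoint[OF assms(2,3)] assms(1) unfolding coloured_def by blast
  qed (rule finI)
  also have "card (\<Union>i\<in>I. F i) \<le> card {e. e \<subseteq> V \<and> card e = 2}"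
    using assms(1) finV unfolding coloured_def by (intro card_mono) auto
  also have "\<dots> = card V * (card V - 1) div 2" using finV by (simp add: n_subsets choose_two)
  finally show ?thesis by simp
qed

text \<open>A bad single colour \<open>{{x, y}}\<close> is one whose contraction would merge the two edges of
  another colour.\<close>

definition bad :: "'i set \<Rightarrow> ('i \<Rightarrow> 'a set set) \<Rightarrow> 'i \<Rightarrow> bool" where
  "bad I F i \<longleftrightarrow> (\<exists>j\<in>I. \<exists>x y z. F i = {{x,y}} \<and> F j = {{x,z},{y,z}} \<and> x \<noteq> y \<and> z \<noteq> x \<and> z \<noteq> y)"

text \<open>The vertex \<open>y\<close> is merged into \<open>x\<close>. No other colour contains
  \<open>{x, y}\<close>, so no loop arises, and as \<open>i\<close> is not bad, no other colour
  loses an edge. Lifting a dense set back may cost one colour and one vertex, hence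
  \<open>Suc B\<close>.\<close>

lemma contract_single:
  fixes V :: "'a set" and F :: "'i \<Rightarrow> 'a set set"
  assumes col: "coloured V I F" and B: "\<not> short I F (Suc B)" "1 \<le> B"
    and i: "i \<in> singles I F" "\<not> bad I F i"
  obtains V' :: "'a set" and F' :: "'i \<Rightarrow> 'a set set" where "coloured V' (I - {i}) F'" "Suc (card V') = card V"
    "Suc (card (singles (I - {i}) F')) = card (singles I F)" "\<not> short (I - {i}) F' B"
proof -
  have iI: "i \<in> I" and c1: "card (F i) = 1" using i unfolding singles_def by auto
  then obtain e0 where e0: "F i = {e0}" by (auto simp: card_1_singleton_iff)
  have "card e0 = 2" "e0 \<subseteq> V" using col e0 iI unfolding coloured_def by auto
  then obtain x y where xy: "e0 = {x,y}" "x \<noteq> y" "x \<in> V" "y \<in> V" by (auto simp: card_2_iff)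
  have disj: "{x,y} \<notin> F j" if "j \<in> I" "j \<noteq> i" for j
    using not_short_disjoint[OF B(1), of i j "{x,y}"] that iI B(2) e0 xy \<open>card e0 = 2\<close> by auto
  define f where "f u = (if u = y then x else u)" for u
  define F' where "F' j = image f ` F j" for j
  have fc: "f ` e = (if y \<in> e then insert x (e - {y}) else e)" for e unfolding f_def by auto
  have edge: "e \<subseteq> V" "card e = 2" "e \<noteq> {x,y}" if "j \<in> I - {i}" "e \<in> F j" for j e
    using that col disj unfolding coloured_def by auto
  have card_f: "card (f ` e) = 2" if "card e = 2" "e \<noteq> {x,y}" for e
  proof -
    show ?thesis
    proof (cases "y \<in> e")
      case True
      from card_2_other[OF that(1) True] obtain u where u: "e = {y,u}" "u \<noteq> y" .
      have "u \<noteq> x"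
      proof
        assume "u = x"
        then show False using that(2) u(1) insert_commute[of x y "{}"] by simp
      qed
      moreover have "f ` e = {x,u}" using u unfolding f_def by auto
      ultimately show ?thesis by simp
    next
      case False
      then show ?thesis using that(1) fc by simp
    qed
  qed
  have inj: "inj_on (image f) (F j)" if j: "j \<in> I - {i}" for j
  proof (rule inj_onI, rule ccontr)
    fix d e assume de: "d \<in> F j" "e \<in> F j" "f ` d = f ` e" "d \<noteq> e"
    \<comment> \<open>By symmetry \<open>y\<close> lies in \<open>d\<close>. Edges with the same
      image are then \<open>{y, z}\<close> and \<open>{x, z}\<close>, and as they exhaust
      \<open>F j\<close>, this makes \<open>i\<close> bad.\<close>
    have sub: "False" if d: "d \<in> F j" "e \<in> F j" "f ` d = f ` e" "d \<noteq> e" "y \<in> d" for d e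
    proof -
      obtain z where z: "d = {y,z}" "z \<noteq> y" using edge[OF j d(1)] d(5) card_2_other by metis
      have "z \<noteq> x" using edge[OF j d(1)] z by auto
      have fd: "f ` d = {x,z}" using z unfolding f_def by auto
      have "y \<notin> e"
      proof
        assume "y \<in> e"
        then obtain t where t: "e = {y,t}" "t \<noteq> y" using edge[OF j d(2)] card_2_other by metis
        then have "t \<noteq> x" using edge[OF j d(2)] by auto
        then show False using fd d t z \<open>z \<noteq> x\<close> unfolding f_def by (auto simp: doubleton_eq_iff)
      qed
      then have e: "e = {x,z}" using fd d(3) fc[of e] by auto
      have "card (F j) \<le> 2" "finite (F j)" using coloured_finite[OF col] col j unfolding coloured_def by auto
      then have "F j = {d,e}" using d card_seteq[of "F j" "{d,e}"] by auto
      then have "F j = {{x,z},{y,z}}" using e z by auto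
      then have "bad I F i" unfolding bad_def using e0 xy j z \<open>z \<noteq> x\<close> by blast
      then show False using i by simp
    qed
    show False
    proof (cases "y \<in> d \<or> y \<in> e")
      case True then show ?thesis using sub[of d e] sub[of e d] de by auto
    next
      case False then show ?thesis using de fc by auto
    qed
  qed
  have cF: "card (F' j) = card (F j)" if "j \<in> I - {i}" for j
    unfolding F'_def using inj[OF that] by (rule card_image)
  show thesis
  proof (rule that[of "V - {y}" F'])
    show "coloured (V - {y}) (I - {i}) F'"
      unfolding coloured_def
    proof (intro conjI ballI)
      show "finite (V - {y})" "finite (I - {i})" using col unfolding coloured_def by auto
      fix j assume j: "j \<in> I - {i}"
      show "F' j \<noteq> {}" using j col unfolding coloured_def F'_def by auto
      show "card (F' j) \<le> 2" using cF[OF j] j col unfolding coloured_def by auto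
      fix e' assume "e' \<in> F' j"
      then obtain e where e: "e \<in> F j" "e' = f ` e" unfolding F'_def by auto
      show "e' \<subseteq> V - {y}" using edge[OF j e(1)] e xy fc[of e] by auto
      show "card e' = 2" using edge[OF j e(1)] e card_f by auto
    qed
    show "Suc (card (V - {y})) = card V"
      using xy col unfolding coloured_def by (intro card_Suc_Diff1) auto
    have "singles (I - {i}) F' = singles I F - {i}" unfolding singles_def using cF by auto
    then show "Suc (card (singles (I - {i}) F')) = card (singles I F)"
      using i coloured_finite_sets(1)[OF col] by (simp only: card_Suc_Diff1)
    show "\<not> short (I - {i}) F' B"
    proof
      assume "short (I - {i}) F' B"
      then obtain J e' where J: "J \<subseteq> I - {i}" "finite J" "J \<noteq> {}" "card J \<le> B"
        "\<forall>j\<in>J. e' j \<in> F' j" "card (\<Union>j\<in>J. e' j) \<le> card J" unfolding short_def by blast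
      have "\<forall>j\<in>J. \<exists>d. d \<in> F j \<and> e' j = f ` d" using J(5) unfolding F'_def by auto
      then obtain e where e: "\<And>j. j \<in> J \<Longrightarrow> e j \<in> F j" "\<And>j. j \<in> J \<Longrightarrow> e' j = f ` e j" by metis
      have fU: "finite (\<Union>j\<in>J. e' j)"
      proof (rule finite_UN_I[OF J(2)])
        fix j assume "j \<in> J"
        then have "card (e j) = 2" using e(1) edge(2)[of j "e j"] J(1) by blast
        then have "finite (e j)" by (intro card_ge_0_finite) simp
        then show "finite (e' j)" using e(2) \<open>j \<in> J\<close> by simp
      qed
      have "short I F (Suc B)"
      proof (cases "x \<in> (\<Union>j\<in>J. e' j)")
        case True
        \<comment> \<open>A contracted edge through \<open>x\<close> may stem from one through
          \<open>y\<close>; adding colour \<open>i\<close> allows for both ends at the price of the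
          one extra vertex \<open>y\<close>. If \<open>x\<close> is not covered, no chosen edge has
          been moved.\<close>
        define d where "d = e(i := {x,y})"
        have "(\<Union>j\<in>insert i J. d j) \<subseteq> insert y (\<Union>j\<in>J. e' j)"
        proof
          fix u assume "u \<in> (\<Union>j\<in>insert i J. d j)"
          then consider "u = x" | "u = y" | j where "j \<in> J" "u \<in> e j" "u \<noteq> y"
            unfolding d_def by (auto split: if_splits)
          then show "u \<in> insert y (\<Union>j\<in>J. e' j)"
          proof cases
            case 3
            then have "u \<in> e' j" using e(2)[of j] fc by auto
            then show ?thesis using 3 by auto
          qed (use True in auto)
        qed
        then have "card (\<Union>j\<in>insert i J. d j) \<le> card (insert y (\<Union>j\<in>J. e' j))"
          using fU by (intro card_mono) auto
        also have "\<dots> \<le> Suc (card (\<Union>j\<in>J. e' j))" using fU by (simp add: card_insert_if)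
        also have "\<dots> \<le> card (insert i J)" using J by (subst card_insert_disjoint) auto
        finally have le: "card (\<Union>j\<in>insert i J. d j) \<le> card (insert i J)" .
        have "card (insert i J) \<le> Suc B" using J by (simp add: card_insert_if)
        moreover have "\<forall>j\<in>insert i J. d j \<in> F j" using e e0 xy unfolding d_def by auto
        ultimately show ?thesis unfolding short_def using le J iI
          by (intro exI[of _ "insert i J"] exI[of _ d]) blast
      next
        case False
        have "e' j = e j" if "j \<in> J" for j
          using e(2)[OF that] False that fc[of "e j"] by (auto split: if_splits)
        then have "short (I - {i}) F B" unfolding short_def using J e by (intro exI[of _ J] exI[of _ e]) auto
        then show ?thesis by (rule short_mono) auto
      qed
      then show False using B by simp
    qed
  qed
qed

text \<open>A bad single colour \<open>{{x, y}}\<close> at \<open>v\<close> has a partner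
  \<open>{{x, z}, {y, z}}\<close>, and \<open>v\<close> lies on just one edge of it. The partner
  determines \<open>{x, y}\<close>, and by disjointness its colour, so the assignment is
  injective.\<close>

lemma all_bad_singles_le_halves:
  assumes col: "coloured V I F" and B: "\<not> short I F B" "2 \<le> B"
    and bad: "\<And>i. i \<in> singles I F \<Longrightarrow> bad I F i"
  shows "card (singles_at I F v) \<le> card (halves I F v)"
proof -
  define Q where "Q i j \<longleftrightarrow> (\<exists>x y z. F i = {{x,y}} \<and> F j = {{x,z},{y,z}} \<and> x \<noteq> y \<and> z \<noteq> x \<and> z \<noteq> y)" for i j
  have "\<forall>i\<in>singles_at I F v. \<exists>j. j \<in> I \<and> Q i j"
  proof
    fix i assume "i \<in> singles_at I F v"
    then have "bad I F i" using bad unfolding singles_at_def singles_def by blast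
    then show "\<exists>j. j \<in> I \<and> Q i j" unfolding bad_def Q_def by (simp only: Bex_def)
  qed
  then obtain t where t: "\<And>i. i \<in> singles_at I F v \<Longrightarrow> t i \<in> I \<and> Q i (t i)" by metis
  show ?thesis
  proof (rule card_inj_on_le)
    show "finite (halves I F v)" using coloured_finite_sets[OF col] by auto
    show "t ` singles_at I F v \<subseteq> halves I F v"
    proof
      fix j assume "j \<in> t ` singles_at I F v"
      then obtain i where i: "i \<in> singles_at I F v" "j = t i" by auto
      then obtain x y z where *: "j \<in> I" "F i = {{x,y}}" "F j = {{x,z},{y,z}}" "x \<noteq> y" "z \<noteq> x" "z \<noteq> y"
        using t[OF i(1)] unfolding Q_def by (elim conjE exE) blast
      have "v = x \<or> v = y" using i * unfolding singles_at_def by auto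
      moreover have "card (F j) = 2" using * by (auto simp: doubleton_eq_iff)
      ultimately show "j \<in> halves I F v" unfolding halves_def using * by auto
    qed
    show "inj_on t (singles_at I F v)"
    proof (rule inj_onI)
      fix i i' assume i: "i \<in> singles_at I F v" "i' \<in> singles_at I F v" "t i = t i'"
      have key: "F k = {\<Union>(F (t k)) - \<Inter>(F (t k))}" if "k \<in> singles_at I F v" for k
      proof -
        obtain x y z where k: "F k = {{x,y}}" "F (t k) = {{x,z},{y,z}}" "x \<noteq> y" "z \<noteq> x" "z \<noteq> y"
          using t[OF \<open>k \<in> singles_at I F v\<close>] unfolding Q_def by (elim conjE exE) blast
        have "\<Union>(F (t k)) = {x,y,z}" "\<Inter>(F (t k)) = {z}" using k by auto
        moreover have "{x,y,z} - {z} = {x,y}" using k by auto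
        ultimately show ?thesis using k(1) by simp
      qed
      have "F i = F i'" using key i by metis
      moreover obtain e where "F i = {e}" "i \<in> I" "i' \<in> I"
        using i unfolding singles_at_def by (auto simp: card_1_singleton_iff)
      moreover from this have "card e = 2" using col unfolding coloured_def by auto
      ultimately show "i = i'" using not_short_disjoint[OF B, of i i' e] by auto
    qed
  qed
qed

text \<open>A star has only one centre, as two edges both containing \<open>u\<close> and
  \<open>v\<close> would coincide. So no colour is counted twice.\<close>

lemma stars_sum:
  assumes "coloured V I F"
  shows "(\<Sum>v\<in>V. card (stars I F v)) + card (singles I F) \<le> card I"
proof -
  have fin: "finite V" "finite I" using assms unfolding coloured_def by auto
  have "(\<Sum>v\<in>V. card (stars I F v)) = card (\<Union>v\<in>V. stars I F v)"
  proof (rule card_UN_disjoint[symmetric])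
    show "\<forall>u\<in>V. \<forall>v\<in>V. u \<noteq> v \<longrightarrow> stars I F u \<inter> stars I F v = {}"
    proof (intro ballI impI, rule ccontr)
      fix u v assume uv: "u \<noteq> v" "stars I F u \<inter> stars I F v \<noteq> {}"
      then obtain i where i: "i \<in> I" "card (F i) = 2" "\<forall>e\<in>F i. u \<in> e \<and> v \<in> e"
        unfolding stars_def by auto
      have "e = {u,v}" if "e \<in> F i" for e
      proof -
        have "card e = 2" using assms i that unfolding coloured_def by blast
        then have "finite e" by (intro card_ge_0_finite) simp
        then show ?thesis using card_seteq[of e "{u,v}"] i that uv \<open>card e = 2\<close> by auto
      qed
      then have "F i \<subseteq> {{u,v}}" by auto
      then have "card (F i) \<le> 1" using card_mono[of "{{u,v}}" "F i"] by simp
      then show False using i by simp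
    qed
  qed (use fin coloured_finite_sets[OF assms] in auto)
  also have "\<dots> + card (singles I F) = card ((\<Union>v\<in>V. stars I F v) \<union> singles I F)"
    using fin coloured_finite_sets[OF assms]
    by (intro card_Un_disjoint[symmetric]) (auto simp: stars_def singles_def)
  also have "\<dots> \<le> card I"
    using fin by (intro card_mono) (auto simp: stars_def singles_def)
  finally show ?thesis .
qed

text \<open>A single colour is dropped if there is one, as the bounds are monotone in their number;
  if there is none, truncated subtraction keeps the count at 0.\<close>

lemma drop_colour:
  assumes "coloured V I F" "I \<noteq> {}"
  obtains i where "i \<in> I" "card (singles (I - {i}) F) = card (singles I F) - 1"
proof (cases "singles I F = {}")
  case True
  obtain i where "i \<in> I" using assms by auto
  moreover have "singles (I - {i}) F = {}" using True unfolding singles_def by auto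
  ultimately show ?thesis using that True by simp
next
  case False
  then obtain i where i: "i \<in> singles I F" by auto
  have "singles (I - {i}) F = singles I F - {i}" unfolding singles_def by auto
  then have "card (singles (I - {i}) F) = card (singles I F) - 1"
    using i coloured_finite_sets(1)[OF assms(1)] by simp
  moreover have "i \<in> I" using i unfolding singles_def by auto
  ultimately show ?thesis using that by blast
qed

section \<open>The induction\<close>

text \<open>With \<open>n\<close> vertices and \<open>a\<close> single colours, these bound the length of a shortest rainbow
  cycle for \<open>n\<close> and for \<open>n + 1\<close> colours, respectively.\<close>

definition bound0 :: "nat \<Rightarrow> nat \<Rightarrow> nat" where
  "bound0 n a = max 2 (if a = 0 then (n + 1) div 2 else (n + a) div 2)"

definition bound1 :: "nat \<Rightarrow> nat \<Rightarrow> nat" where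
  "bound1 n a = max 2 ((n + a - 2) div 2)"

text \<open>Both bounds have to be available together: a deletion that kills \<open>k\<close>
  colours changes the excess of colours over vertices by \<open>1 - k\<close>.\<close>

locale induction_step =
  fixes V :: "'a set" and I :: "'i set" and F :: "'i \<Rightarrow> 'a set set"
  assumes col: "coloured V I F"
    and smaller0: "\<And>(W :: 'a set) (J :: 'i set) (G :: 'i \<Rightarrow> 'a set set).
      \<lbrakk>coloured W J G; card W < card V; card W > 0; card J = card W\<rbrakk>
      \<Longrightarrow> short J G (bound0 (card W) (card (singles J G)))"
    and smaller1: "\<And>(W :: 'a set) (J :: 'i set) (G :: 'i \<Rightarrow> 'a set set).
      \<lbrakk>coloured W J G; card W < card V; card J = card W + 1; card (singles J G) \<ge> 3\<rbrakk>
      \<Longrightarrow> short J G (bound1 (card W) (card (singles J G)))"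
begin

abbreviation "n \<equiv> card V"
abbreviation "a \<equiv> card (singles I F)"
abbreviation "s v \<equiv> card (stars I F v)"
abbreviation "g v \<equiv> card (singles_at I F v)"
abbreviation "h v \<equiv> card (halves I F v)"

lemma fin: "finite V" "finite I"
  using col unfolding coloured_def by auto

lemma g_le_a: "g v \<le> a"
  using coloured_finite_sets(1)[OF col] by (intro card_mono) (auto simp: singles_def singles_at_def)

lemma a_le: "a \<le> card I"
  using fin by (intro card_mono) (auto simp: singles_def)

lemma degrees: "(\<Sum>v\<in>V. 2 * s v + g v + h v) + 2 * a = 4 * card I"
  using degree_sum[OF col] .

lemma card_remove_vertex:
  assumes "v \<in> V"
  shows "card (V - {v}) = n - 1" "card (V - {v}) < n"
  using assms fin by (simp, intro card_Diff1_less)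

lemma deleted_singles:
  "card (singles (survivors I F v) (deleted v F)) = a + h v - g v"
  using deleted_singles_card[OF col, of v] by simp

section \<open>Reductions to smaller instances\<close>

text \<open>The digit in \<open>delete0\<close>, \<open>delete1\<close> and \<open>delete2\<close>
  is the excess of colours over vertices after the deletion. For excess 0 a vertex has to remain,
  hence \<open>2 \<le> n\<close>.\<close>

lemma delete0:
  assumes "v \<in> V" "2 \<le> n" "Suc (card I) = n + (s v + g v)" "bound0 (n - 1) (a + h v - g v) \<le> B"
  shows "short I F B"
proof (rule deleted_short)
  have "card (survivors I F v) = card (V - {v})"
    using survivors_card[OF col, of v] assms card_remove_vertex[of v] by linarith
  with smaller0[OF deleted_coloured[OF col, of v]] assms card_remove_vertex[of v]
  show "short (survivors I F v) (deleted v F) (bound0 (n - 1) (a + h v - g v))"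
    by (simp add: deleted_singles)
qed (fact assms)

lemma delete1:
  assumes "v \<in> V" "card I = n + (s v + g v)" "3 + g v \<le> a + h v" "bound1 (n - 1) (a + h v - g v) \<le> B"
  shows "short I F B"
proof (rule deleted_short)
  have "n > 0" using assms(1) fin by (auto simp: card_gt_0_iff)
  then have "card (survivors I F v) = card (V - {v}) + 1"
    using survivors_card[OF col, of v] assms card_remove_vertex[of v] by linarith
  with smaller1[OF deleted_coloured[OF col, of v]] assms card_remove_vertex[of v]
  show "short (survivors I F v) (deleted v F) (bound1 (n - 1) (a + h v - g v))"
    by (simp add: deleted_singles)
qed (fact assms)

text \<open>For excess 1 after the deletion when fewer than three single colours may be left: a
  further colour is dropped to reach excess 0.\<close>

lemma delete_drop:
  assumes "v \<in> V" "2 \<le> n" "card I = n + (s v + g v)" "bound0 (n - 1) (a + h v - g v - 1) \<le> B"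
  shows "short I F B"
proof -
  let ?I = "survivors I F v"
  have c: "card ?I = n" using survivors_card[OF col, of v] assms by linarith
  then have "?I \<noteq> {}" using assms(2) by auto
  from drop_colour[OF deleted_coloured[OF col] this]
  obtain i where i: "i \<in> ?I"
    "card (singles (?I - {i}) (deleted v F)) = card (singles ?I (deleted v F)) - 1" by blast
  have "coloured (V - {v}) (?I - {i}) (deleted v F)"
    using coloured_subset[OF deleted_coloured[OF col]] by blast
  from smaller0[OF this] have "short (?I - {i}) (deleted v F) (bound0 (n - 1) (a + h v - g v - 1))"
    using i c assms card_remove_vertex[of v] coloured_finite_sets(5)[OF col, of v]
    by (simp add: deleted_singles)
  then have "short ?I (deleted v F) B" by (rule short_mono) (use assms in auto)
  then show ?thesis by (rule deleted_short) simp
qed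

lemma delete2:
  assumes "v \<in> V" "card I = n + 1 + (s v + g v)" "(n + 1) div 2 \<le> B"
  shows "short I F B"
proof (rule deleted_short)
  have n: "n > 0" using assms(1) fin by (auto simp: card_gt_0_iff)
  then have "card (survivors I F v) = card (V - {v}) + 2"
    using survivors_card[OF col, of v] assms card_remove_vertex[of v] by linarith
  from short_excess_two[OF deleted_coloured[OF col] this]
  show "short (survivors I F v) (deleted v F) ((n + 1) div 2)"
    using n card_remove_vertex[OF assms(1)] by simp
qed (fact assms)

text \<open>Contraction keeps the excess; the strict inequality pays for the colour that lifting may
  add.\<close>

lemma contract0:
  assumes "i \<in> singles I F" "\<not> bad I F i" "card I = n" "2 \<le> n"
    and "bound0 (n - 1) (a - 1) < B"
  shows "short I F B"
proof (rule ccontr)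
  assume ns: "\<not> short I F B"
  obtain C where C: "B = Suc C" using assms(5) by (cases B) auto
  have "1 \<le> C" using assms(5) C unfolding bound0_def by auto
  from contract_single[OF col ns[unfolded C] this assms(1,2)]
  obtain W :: "'a set" and G :: "'i \<Rightarrow> 'a set set" where W: "coloured W (I - {i}) G" "Suc (card W) = n"
    "Suc (card (singles (I - {i}) G)) = a" "\<not> short (I - {i}) G C" .
  have "i \<in> I" using assms(1) unfolding singles_def by auto
  then have "short (I - {i}) G (bound0 (card W) (card (singles (I - {i}) G)))"
    using W assms fin by (intro smaller0) auto
  moreover have "card W = n - 1" "card (singles (I - {i}) G) = a - 1" using W by auto
  ultimately have "short (I - {i}) G C"
    using assms(5) C by (auto elim!: short_mono)
  then show False using W by simp
qed

lemma contract1: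
  assumes "i \<in> singles I F" "\<not> bad I F i" "card I = n + 1" "4 \<le> a"
    and "bound1 (n - 1) (a - 1) < B"
  shows "short I F B"
proof (rule ccontr)
  assume ns: "\<not> short I F B"
  obtain C where C: "B = Suc C" using assms(5) by (cases B) auto
  have "1 \<le> C" using assms(5) C unfolding bound1_def by auto
  from contract_single[OF col ns[unfolded C] this assms(1,2)]
  obtain W :: "'a set" and G :: "'i \<Rightarrow> 'a set set" where W: "coloured W (I - {i}) G" "Suc (card W) = n"
    "Suc (card (singles (I - {i}) G)) = a" "\<not> short (I - {i}) G C" .
  have "i \<in> I" using assms(1) unfolding singles_def by auto
  then have "short (I - {i}) G (bound1 (card W) (card (singles (I - {i}) G)))"
    using W assms fin by (intro smaller1) auto
  moreover have "card W = n - 1" "card (singles (I - {i}) G) = a - 1" using W by auto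
  ultimately have "short (I - {i}) G C"
    using assms(5) C by (auto elim!: short_mono)
  then show False using W by simp
qed

section \<open>The cases of the induction step\<close>

text \<open>The degrees sum to \<open>4 * n + 4 - 2 * a\<close>. Deletions force degree at least 4
  except at vertices with three single colours and nothing else; contraction excludes these for
  \<open>4 \<le> a\<close>, and for \<open>a = 3\<close> there is only one of them.\<close>

lemma step1:
  assumes cI: "card I = n + 1" and a3: "3 \<le> a"
  shows "short I F (bound1 n a)"
proof (rule ccontr)
  assume ns: "\<not> short I F (bound1 n a)"
  have b2: "2 \<le> bound1 n a" unfolding bound1_def by simp
  have e: "4 * (n + 1) \<le> 2 * a + n * (n - 1)" using not_short_card_edges[OF col ns b2] cI by simp
  \<comment> \<open>The edge count excludes small instances, so the bound is at least 3 and the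
    \<open>max 2\<close> in the bounds of smaller instances does no harm.\<close>
  have n4: "4 \<le> n \<and> 8 \<le> n + a"
  proof (rule ccontr)
    assume small: "\<not> ?thesis"
    then have "n = 0 \<or> n = 1 \<or> n = 2 \<or> n = 3 \<or> n = 4" using a3 by linarith
    then show False using e a_le cI a3 small by auto
  qed
  then have B: "bound1 n a = (n + a - 2) div 2" unfolding bound1_def by auto
  \<comment> \<open>Deleting \<open>v\<close> leaves excess \<open>2 - (s v + g v)\<close>. The
    values 0, 1 and 2 of \<open>s v + g v\<close> are each settled by a deletion unless
    \<open>h v\<close> is large; larger values give degree 4 directly, up to the exception.\<close>
  have deg: "4 \<le> 2 * s v + g v + h v \<or> s v = 0 \<and> g v = 3 \<and> h v = 0" if v: "v \<in> V" for v
  proof -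
    have "s v + g v \<noteq> 0"
    proof
      assume "s v + g v = 0"
      then have "short I F (bound1 n a)" using v cI a3 B by (intro delete2[of v]) auto
      then show False using ns by simp
    qed
    moreover have "h v \<ge> g v + 2" if d: "s v + g v = 1"
    proof (rule ccontr)
      assume le: "\<not> ?thesis"
      have "short I F (bound1 n a)"
      proof (cases "3 + g v \<le> a + h v")
        case True
        show ?thesis
          by (rule delete1[OF v _ True]) (use cI d B le n4 in \<open>auto simp: bound1_def\<close>)
      next
        case False
        \<comment> \<open>Only two single colours would survive, too few for
          \<open>delete1\<close>.\<close>
        then have "a = 3" "g v = 1" "h v = 0" using a3 d by auto
        then show ?thesis using cI d n4
          by (intro delete_drop[OF v]) (auto simp: bound1_def bound0_def)
      qed
      then show False using ns by simp
    qed
    moreover have "h v \<ge> g v" if d: "s v + g v = 2"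
    proof (rule ccontr)
      assume le: "\<not> ?thesis"
      have "short I F (bound1 n a)"
        by (rule delete0[OF v]) (use cI d B le n4 a3 in \<open>auto simp: bound0_def\<close>)
      then show False using ns by simp
    qed
    ultimately show ?thesis by linarith
  qed
  show False
  proof (cases "4 \<le> a")
    case True
    have "bad I F i" if "i \<in> singles I F" for i
    proof (rule ccontr)
      assume nb: "\<not> ?thesis"
      have "n + a - 2 = n - 1 + (a - 1) - 2 + 2" using n4 True by linarith
      then have "bound1 n a = Suc ((n - 1 + (a - 1) - 2) div 2)" using B by simp
      then have "short I F (bound1 n a)"
        by (intro contract1[OF that nb cI True]) (use n4 in \<open>auto simp: bound1_def\<close>)
      then show False using ns by simp
    qed
    then have gh: "g v \<le> h v" for v using all_bad_singles_le_halves[OF col ns b2] by blast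
    have "4 \<le> 2 * s v + g v + h v" if "v \<in> V" for v using deg[OF that] gh[of v] by linarith
    then have "(\<Sum>v\<in>V. 4) \<le> (\<Sum>v\<in>V. 2 * s v + g v + h v)" by (intro sum_mono) auto
    then show False using degrees cI True by simp
  next
    case False
    then have a: "a = 3" using a3 by simp
    \<comment> \<open>Now the degrees sum to \<open>4 * n - 2\<close>, so an exceptional vertex
      exists; its uniqueness will give a sum of at least \<open>4 * n - 1\<close>.\<close>
    have "\<exists>v\<in>V. \<not> 4 \<le> 2 * s v + g v + h v"
    proof (rule ccontr)
      assume "\<not> ?thesis"
      then have "(\<Sum>v\<in>V. 4) \<le> (\<Sum>v\<in>V. 2 * s v + g v + h v)" by (intro sum_mono) auto
      then show False using degrees cI a by simp
    qed
    then obtain v where v: "v \<in> V" "\<not> 4 \<le> 2 * s v + g v + h v" by blast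
    then have gv: "s v = 0" "g v = 3" "h v = 0" using deg by auto
    have all: "singles_at I F w = singles I F" if "g w = 3" for w
      using that a coloured_finite_sets(1)[OF col]
      by (intro card_subset_eq) (auto simp: singles_at_def singles_def)
    have "4 \<le> 2 * s w + g w + h w" if w: "w \<in> V - {v}" for w
    proof (rule ccontr)
      assume "\<not> ?thesis"
      then have "g w = 3" using deg w by auto
      then have sub: "singles I F = singles_at I F v" "singles I F = singles_at I F w"
        using all gv by auto
      \<comment> \<open>With two exceptional vertices, all three single colours would share one
        edge.\<close>
      have vw: "F i = {{v,w}}" if i: "i \<in> singles I F" for i
      proof -
        obtain e where e: "F i = {e}" using i unfolding singles_def by (auto simp: card_1_singleton_iff)
        have "i \<in> singles_at I F v" using i by (simp only: sub(1)[symmetric])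
        moreover have "i \<in> singles_at I F w" using i by (simp only: sub(2)[symmetric])
        ultimately have "v \<in> e" "w \<in> e" using e unfolding singles_at_def by auto
        moreover have c: "card e = 2" using col i e unfolding coloured_def singles_def by auto
        moreover have "finite e" using c by (intro card_ge_0_finite) simp
        ultimately show ?thesis using card_seteq[of e "{v,w}"] card_2_iff[of "{v,w}"] w e by force
      qed
      have "is_singleton (singles I F)"
      proof (rule is_singletonI')
        show "singles I F \<noteq> {}" using a by auto
        fix i j assume ij: "i \<in> singles I F" "j \<in> singles I F"
        then have "i \<in> I" "j \<in> I" unfolding singles_def by auto
        moreover have "{v,w} \<in> F i" "{v,w} \<in> F j" using vw ij by blast+
        moreover have "card {v,w} = 2" using w by (auto simp: card_2_iff)
        ultimately show "i = j" using not_short_disjoint[OF ns b2] by blast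
      qed
      then show False using a by (simp add: is_singleton_altdef)
    qed
    then have "(\<Sum>w\<in>V-{v}. 4) \<le> (\<Sum>w\<in>V-{v}. 2 * s w + g w + h w)" by (intro sum_mono) auto
    moreover have "(\<Sum>w\<in>V. 2 * s w + g w + h w) =
        (2 * s v + g v + h v) + (\<Sum>w\<in>V-{v}. 2 * s w + g w + h w)"
      using fin v by (intro sum.remove) auto
    ultimately show False using degrees cI a gv n4 card_remove_vertex[OF v(1)] by simp
  qed
qed

text \<open>The degrees sum to \<open>4 * n - 2 * a\<close>. If all single colours were bad,
  \<open>g v \<le> h v\<close> would raise every degree to 4. So a contraction is possible, and it
  settles \<open>2 \<le> a\<close>. For \<open>a = 1\<close> it would lead to \<open>a = 0\<close>,
  where the bound rounds up, so the degrees are determined exactly instead.\<close>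

lemma step0_pos:
  assumes cI: "card I = n" and a1: "1 \<le> a"
  shows "short I F (bound0 n a)"
proof (rule ccontr)
  assume ns: "\<not> short I F (bound0 n a)"
  have b2: "2 \<le> bound0 n a" unfolding bound0_def by simp
  have e: "4 * n \<le> 2 * a + n * (n - 1)" using not_short_card_edges[OF col ns b2] cI by simp
  have n3: "3 \<le> n \<and> 6 \<le> n + a"
  proof (rule ccontr)
    assume small: "\<not> ?thesis"
    then have "n = 0 \<or> n = 1 \<or> n = 2 \<or> n = 3 \<or> n = 4" using a1 by linarith
    then show False using e a_le cI a1 small by auto
  qed
  then have B: "bound0 n a = (n + a) div 2" using a1 unfolding bound0_def by auto
  \<comment> \<open>Deletion of \<open>v\<close> leaves excess 1. Three halves supply the single
    colours that \<open>delete1\<close> requires; for fewer halves dropping a colour is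
    affordable.\<close>
  have d0: "4 \<le> h v" if v: "v \<in> V" and d: "s v + g v = 0" for v
  proof (rule ccontr)
    assume le: "\<not> ?thesis"
    have "short I F (bound0 n a)"
    proof (cases "h v = 3")
      case True
      show ?thesis
        by (rule delete1[OF v]) (use True cI d B n3 a1 in \<open>auto simp: bound1_def\<close>)
    next
      case False
      then show ?thesis using cI d B n3 a1 le by (intro delete_drop[OF v]) (auto simp: bound0_def)
    qed
    then show False using ns by simp
  qed
  have d1: "g v + 2 \<le> h v" if v: "v \<in> V" and d: "s v + g v = 1" for v
  proof (rule ccontr)
    assume le: "\<not> ?thesis"
    have "short I F (bound0 n a)"
      by (rule delete0[OF v]) (use cI d B le n3 a1 in \<open>auto simp: bound0_def\<close>)
    then show False using ns by simp
  qed
  have "\<exists>i\<in>singles I F. \<not> bad I F i"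
  proof (rule ccontr)
    assume "\<not> ?thesis"
    then have gh: "g v \<le> h v" for v using all_bad_singles_le_halves[OF col ns b2] by blast
    have "4 \<le> 2 * s v + g v + h v" if v: "v \<in> V" for v
      using d0[OF v] d1[OF v] gh[of v] by linarith
    then have "(\<Sum>v\<in>V. 4) \<le> (\<Sum>v\<in>V. 2 * s v + g v + h v)" by (intro sum_mono) auto
    then show False using degrees cI a1 by simp
  qed
  then obtain i where i: "i \<in> singles I F" "\<not> bad I F i" by blast
  show False
  proof (cases "2 \<le> a")
    case True
    have "short I F (bound0 n a)"
      by (rule contract0[OF i cI]) (use True B n3 in \<open>auto simp: bound0_def\<close>)
    then show False using ns by simp
  next
    case False
    then have a: "a = 1" using a1 by simp
    then have n5: "5 \<le> n" using n3 by simp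
    have si: "singles I F = {i}" using a i by (metis card_1_singleton_iff singletonD One_nat_def)
    have iI: "i \<in> I" using i unfolding singles_def by auto
    obtain e0 where e0: "F i = {e0}" using i unfolding singles_def by (auto simp: card_1_singleton_iff)
    have "e0 \<subseteq> V" "card e0 = 2" using col iI e0 unfolding coloured_def by auto
    then obtain x y where xy: "e0 = {x,y}" "x \<noteq> y" "x \<in> V" "y \<in> V" by (auto simp: card_2_iff)
    have "singles_at I F v = (if v = x \<or> v = y then {i} else {})" for v
    proof -
      have "singles_at I F v = {k \<in> singles I F. \<forall>e\<in>F k. v \<in> e}"
        unfolding singles_at_def singles_def by auto
      then show ?thesis using si e0 xy by auto
    qed
    then have g: "g v = (if v = x \<or> v = y then 1 else 0)" for v by simp
    define d where "d v = 2 * s v + g v + h v" for v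
    have dV: "4 \<le> d v" if "v \<in> V - {x,y}" for v
      using d0[of v] d1[of v] that unfolding d_def g by (cases "s v = 0"; cases "s v = 1") auto
    have dxy: "3 \<le> d v" "d v \<le> 3 \<Longrightarrow> s v = 1 \<and> h v = 0" if "v = x \<or> v = y" for v
      using d1[of v] that xy unfolding d_def g by (cases "s v = 0", auto)+
    have sumd: "(\<Sum>v\<in>V. d v) + 2 = 4 * n" using degrees cI a unfolding d_def by simp
    have split: "(\<Sum>v\<in>V. d v) = d x + d y + (\<Sum>v\<in>V-{x,y}. d v)"
    proof -
      have "(\<Sum>v\<in>V. d v) = (\<Sum>v\<in>V-{x,y}. d v) + (\<Sum>v\<in>{x,y}. d v)"
        using fin xy by (intro sum.subset_diff) auto
      then show ?thesis using xy by simp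
    qed
    have cW: "card (V - {x,y}) = n - 2" using xy fin by (simp add: card_Diff_subset)
    have ge: "4 * (n - 2) \<le> (\<Sum>v\<in>V-{x,y}. d v)"
      using sum_mono[of "V - {x,y}" "\<lambda>_. 4" d] dV cW by simp
    have d3: "3 \<le> d x" "3 \<le> d y" using dxy(1) by auto
    \<comment> \<open>The degrees sum to \<open>4 * n - 2\<close> and the other vertices take at
      least \<open>4 * (n - 2)\<close>, which leaves at most 6 for \<open>x\<close> and
      \<open>y\<close>.\<close>
    have dx: "d x \<le> 3" "d y \<le> 3" using d3 sumd split ge n5 by linarith+
    have sx: "s x = 1" "h x = 0" "s y = 1" "h y = 0" using dxy(2)[of x] dxy(2)[of y] dx by auto
    have "(\<Sum>v\<in>V-{x,y}. d v) = 4 * (n - 2)"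
      using d3 dx sumd split ge n5 by linarith
    then have eq: "(\<Sum>v\<in>V-{x,y}. 4) = (\<Sum>v\<in>V-{x,y}. d v)" using cW by simp
    then have d4: "d v = 4" if "v \<in> V - {x,y}" for v
      using sum_mono_inv[OF eq dV that] fin by simp
    \<comment> \<open>Otherwise every vertex is the centre of a star, and with \<open>i\<close>
      there would be \<open>n + 1\<close> colours.\<close>
    have "\<exists>u\<in>V-{x,y}. s u = 0"
    proof (rule ccontr)
      assume no: "\<not> ?thesis"
      have "1 \<le> s v" if "v \<in> V" for v
      proof (cases "v = x \<or> v = y")
        case True
        then show ?thesis using sx by auto
      next
        case False
        then have "v \<in> V - {x,y}" using that by simp
        then have "s v \<noteq> 0" using no by (metis (no_types))
        then show ?thesis by simp
      qed
      then have "(\<Sum>v\<in>V. 1) \<le> (\<Sum>v\<in>V. s v)" by (intro sum_mono) auto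
      then show False using stars_sum[OF col] a cI by simp
    qed
    then obtain u where u: "u \<in> V" "u \<noteq> x" "u \<noteq> y" "s u = 0" by blast
    then have hu: "h u = 4" "g u = 0" using d4[of u] g[of u] unfolding d_def by auto
    \<comment> \<open>The tight case: the only colours at \<open>x\<close> and \<open>y\<close> are one star at each and the single
      colour \<open>i\<close>, so deleting \<open>x\<close>, \<open>y\<close>, \<open>u\<close> kills exactly three colours.\<close>
    define J where "J = I - (stars I F x \<union> stars I F y \<union> {i})"
    have untouched: "x \<notin> e \<and> y \<notin> e" if "j \<in> J" "e \<in> F j" for j e
    proof -
      have j: "j \<in> I" "j \<notin> singles I F" "j \<notin> stars I F x" "j \<notin> stars I F y"
        using that si unfolding J_def by auto
      then have "card (F j) = 2" using coloured_card[OF col, of j] unfolding singles_def by auto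
      moreover have "j \<notin> halves I F x" "j \<notin> halves I F y"
        using sx coloured_finite_sets(4)[OF col] by auto
      ultimately show ?thesis using j that unfolding stars_def halves_def by auto
    qed
    have cJ: "card J = n - 3"
    proof -
      obtain j k where jk: "stars I F x = {j}" "stars I F y = {k}"
        using sx by (auto simp: card_1_singleton_iff)
      then have mem: "j \<in> stars I F x" "k \<in> stars I F y" by auto
      then have "j \<in> I" "k \<in> I" unfolding stars_def by auto
      have "card (F j) = 2" "card (F k) = 2" using mem unfolding stars_def by auto
      then have "j \<noteq> i" "k \<noteq> i" using e0 by auto
      moreover have "j \<noteq> k"
      proof
        assume "j = k"
        have c2: "card (F j) = 2" "\<forall>e\<in>F j. x \<in> e" "\<forall>e\<in>F j. y \<in> e"
          using mem \<open>j = k\<close> unfolding stars_def by auto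
        have "e = {x,y}" if "e \<in> F j" for e
        proof -
          have c: "card e = 2" using col \<open>j \<in> I\<close> that unfolding coloured_def by blast
          then have "finite e" by (intro card_ge_0_finite) simp
          then show ?thesis using card_seteq[of e "{x,y}"] c2 that xy c by auto
        qed
        then have "F j \<subseteq> {{x,y}}" by auto
        then show False using c2 card_mono[of "{{x,y}}" "F j"] by simp
      qed
      moreover have "J = I - {i,j,k}" unfolding J_def jk by auto
      ultimately show ?thesis using iI cI fin \<open>j \<in> I\<close> \<open>k \<in> I\<close> by (simp add: card_Diff_subset)
    qed
    have Jsub: "J \<subseteq> I" unfolding J_def by auto
    have colJ: "coloured (V - {x,y}) J F"
      using coloured_subset[OF col Jsub] untouched unfolding coloured_def by blast
    have "stars J F u \<subseteq> stars I F u" "singles_at J F u \<subseteq> singles_at I F u"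
      "halves J F u \<subseteq> halves I F u"
      using Jsub unfolding stars_def singles_at_def halves_def by auto
    then have "stars J F u = {}" "singles_at J F u = {}" "card (halves J F u) \<le> 4"
      using u hu coloured_finite_sets(2-4)[OF col, of u] card_mono[of "halves I F u" "halves J F u"] by auto
    moreover have "singles J F = {}" using si unfolding J_def singles_def by auto
    ultimately have surv: "survivors J F u = J" and a4: "card (singles J (deleted u F)) \<le> 4"
      using deleted_singles_card[OF colJ, of u] unfolding survivors_def by auto
    have "card (V - {x,y} - {u}) = n - 3" using cW u fin by simp
    then have "short J (deleted u F) (bound0 (n - 3) (card (singles J (deleted u F))))"
      using smaller0[OF deleted_coloured[OF colJ, of u]] surv cJ n5 by simp
    \<comment> \<open>Deleting \<open>u\<close> makes at most four colours single, and
      \<open>(n - 3 + 4) div 2 = (n + 1) div 2\<close>.\<close>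
    moreover have "bound0 (n - 3) (card (singles J (deleted u F))) \<le> bound0 n a"
      using a4 n5 unfolding B a bound0_def by auto
    ultimately have "short I F (bound0 n a)"
      using Jsub by (elim short_mono) (auto simp: deleted_def)
    then show False using ns by simp
  qed
qed

text \<open>The degrees sum to \<open>4 * n\<close>, and deletions make each at least 4, with
  equality only at centres of two or more stars. Hence every vertex is such a centre, but there are
  only \<open>n\<close> colours.\<close>

lemma step0_zero:
  assumes cI: "card I = n" and n0: "0 < n" and a: "a = 0"
  shows "short I F (bound0 n a)"
proof (rule ccontr)
  assume ns: "\<not> short I F (bound0 n a)"
  have b2: "2 \<le> bound0 n a" unfolding bound0_def by simp
  have e: "4 * n \<le> n * (n - 1)" using not_short_card_edges[OF col ns b2] cI a by simp
  then have n5: "5 \<le> n" using n0 by simp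
  then have B: "bound0 n a = (n + 1) div 2" using a unfolding bound0_def by auto
  have g: "g v = 0" for v using g_le_a[of v] a by simp
  have d0: "5 \<le> h v" if v: "v \<in> V" and d: "s v = 0" for v
  proof (rule ccontr)
    assume le: "\<not> ?thesis"
    have "short I F (bound0 n a)"
    proof (cases "3 \<le> h v")
      case True
      show ?thesis
        by (rule delete1[OF v]) (use True cI d B n5 g a le in \<open>auto simp: bound1_def\<close>)
    next
      case False
      then show ?thesis using cI d B n5 a g by (intro delete_drop[OF v]) (auto simp: bound0_def)
    qed
    then show False using ns by simp
  qed
  have d1: "3 \<le> h v" if v: "v \<in> V" and d: "s v = 1" for v
  proof (rule ccontr)
    assume le: "\<not> ?thesis"
    have "short I F (bound0 n a)"
      by (rule delete0[OF v]) (use cI d B le n5 g a in \<open>auto simp: bound0_def\<close>)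
    then show False using ns by simp
  qed
  have deg: "4 \<le> 2 * s v + g v + h v \<and> (s v < 2 \<longrightarrow> 4 < 2 * s v + g v + h v)" if v: "v \<in> V" for v
    using d0[OF v] d1[OF v] by linarith
  have "\<forall>v\<in>V. 2 \<le> s v"
  proof (rule ccontr)
    assume "\<not> ?thesis"
    then have "(\<Sum>v\<in>V. 4) < (\<Sum>v\<in>V. 2 * s v + g v + h v)"
      using deg fin by (intro sum_strict_mono_ex1) (auto simp: not_le)
    then show False using degrees cI a by simp
  qed
  then have "(\<Sum>v\<in>V. 2) \<le> (\<Sum>v\<in>V. s v)" by (intro sum_mono) auto
  then show False using stars_sum[OF col] cI n0 by simp
qed

end

lemma short_bounds:
  fixes V :: "'a set" and I :: "'i set" and F :: "'i \<Rightarrow> 'a set set"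
  assumes "coloured V I F"
  shows "(0 < card V \<longrightarrow> card I = card V \<longrightarrow> short I F (bound0 (card V) (card (singles I F)))) \<and>
    (card I = card V + 1 \<longrightarrow> 3 \<le> card (singles I F) \<longrightarrow> short I F (bound1 (card V) (card (singles I F))))"
  using assms
proof (induction "card V" arbitrary: V I F rule: less_induct)
  case less
  interpret induction_step V I F
    using less.prems less.hyps by unfold_locales blast+
  show ?case using step1 step0_pos step0_zero by (metis One_nat_def Suc_leI neq0_conv)
qed

section \<open>From the bounds to the sum of reciprocals\<close>

lemma sum_inverse_card:
  assumes "coloured V I F"
  shows "(\<Sum>i\<in>I. 1 / real (card (F i))) = real (card I + card (singles I F)) / 2"
proof -
  have "(\<Sum>i\<in>I. 1 / real (card (F i))) = (\<Sum>i\<in>I. 1 / 2 + (if i \<in> singles I F then 1 / 2 else 0))"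
    using coloured_card[OF assms] by (intro sum.cong) (fastforce simp: singles_def)+
  moreover have "I \<inter> singles I F = singles I F" unfolding singles_def by auto
  moreover have "finite I" using assms unfolding coloured_def by simp
  ultimately show ?thesis by (simp add: sum.distrib sum.If_cases add_divide_distrib)
qed

theorem theorem1p6:
  fixes V :: "'a set" and E :: "'a set set" and F :: "nat \<Rightarrow> 'a set set" and n :: nat
  assumes "simple_graph V E"
    and "card V = n" and "n \<ge> 1"
    and "\<And>i. i \<in> {1..n} \<Longrightarrow> F i \<subseteq> E \<and> F i \<noteq> {} \<and> card (F i) \<le> 2"
  shows "\<exists>vs. rainbow_cycle E {1..n} F vs \<and>
           int (length vs) \<le> \<lceil>\<Sum>i=1..n. 1 / real (card (F i))\<rceil>"
proof -
  let ?I = "{1..n}"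
  define a where "a = card (singles ?I F)"
  have edge: "e \<subseteq> V \<and> card e = 2" if "i \<in> ?I" "e \<in> F i" for i e
    using assms(1,4) that unfolding simple_graph_def by blast
  have col: "coloured V ?I F"
    using assms(1,4) edge unfolding coloured_def simple_graph_def by auto
  have sh: "short ?I F (bound0 n a)"
    using short_bounds[OF col] assms(2,3) unfolding a_def by simp
  have finV: "finite V" using assms(1) unfolding simple_graph_def by simp
  have one: "1 \<in> ?I" using assms(3) by simp
  then obtain e where e: "e \<in> F 1" using assms(4) by blast
  then have e2: "e \<subseteq> V" "card e = 2" using edge one by blast+
  then have n2: "2 \<le> n" using card_mono[OF finV, of e] assms(2) by simp
  \<comment> \<open>This makes the claimed bound at least 2, as the \<open>max 2\<close> in
    \<open>bound0\<close> demands. On two vertices all edges coincide, so colour 1 is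
    single.\<close>
  have "3 \<le> n + a"
  proof (cases "n = 2")
    case True
    have "d = V" if "d \<in> F 1" for d
      using edge[OF one that] True assms(2) finV by (intro card_subset_eq) auto
    then have "F 1 = {V}" using e by blast
    then have "1 \<in> singles ?I F" using one unfolding singles_def by simp
    then have "a \<noteq> 0" using coloured_finite_sets(1)[OF col] unfolding a_def by auto
    then show ?thesis using True by simp
  qed (use n2 in simp)
  then have "bound0 n a \<le> (n + a + 1) div 2" unfolding bound0_def by (auto intro: div_le_mono)
  then have "short ?I F ((n + a + 1) div 2)" using short_mono[OF sh] by blast
  then obtain vs where vs: "rainbow_cycle E ?I F vs" "length vs \<le> (n + a + 1) div 2"
    using rainbow_cycle_of_short[OF col] assms(4) by meson
  have "(\<Sum>i=1..n. 1 / real (card (F i))) = real (n + a) / 2"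
    using sum_inverse_card[OF col] unfolding a_def by simp
  moreover have "int ((n + a + 1) div 2) \<le> \<lceil>real (n + a) / 2\<rceil>"
  proof -
    define c where "c = \<lceil>real (n + a) / 2\<rceil>"
    have "real (n + a) / 2 \<le> of_int c" unfolding c_def by (rule le_of_int_ceiling)
    then have "real_of_int (int (n + a)) \<le> real_of_int (2 * c)" by simp
    then have "int (n + a) \<le> 2 * c" by (simp only: of_int_le_iff)
    then show ?thesis unfolding c_def[symmetric] by linarith
  qed
  ultimately have "int (length vs) \<le> \<lceil>\<Sum>i=1..n. 1 / real (card (F i))\<rceil>"
    using vs(2) by (metis of_nat_mono order_trans)
  then show ?thesis using vs(1) by blast
qed

end
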